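(* For any two positive integers $n$ and $x$ with $x\le 2^{n/2}$, there is a set $S(n,x)$ of $n$ points in general position in $\mathbb{R}^2\subset\mathbb{R}\mathcal{P}^2$ containing at most $O(x+n^2)$ affine holes in $\mathbb{R}^2$ and at least $\Omega(x^2)$ projective holes.
   Context: A finite point set is in general position if no three of its points lie on a common line. For a finite set $S\subset\mathbb{R}^2$ in general position, an affine $k$-hole in $S$ is a convex polygon with $k$ vertices, all in $S$, containing no point of $S$ in its interior; an affine hole is an affine $k$-hole for some $k\ge3$. A Euclidean plane $\rho\subset\mathbb{R}\mathcal{P}^2$ is the set obtained by removing a projective line. A subset $X\subset\mathbb{R}\mathcal{P}^2$ is semiconvex if any two points of $X$ can be joined by a (projective) line segment contained in $X$; it is convex if it is semiconvex and contained in some Euclidean plane. A projective convex hull of $Y$ is an inclusion-wise minimal convex subset of $\mathbb{R}\mathcal{P}^2$ containing $Y$ (not necessarily unique). For a finite set $P\subset\mathbb{R}\mathcal{P}^2$ in general position, a projective $k$-gon determined by $P$ is a projective convex hull of a set $G$ of $k$ points of $P$ which contains all points of $G$ on its boundary; equivalently, a subset of $\mathbb{R}\mathcal{P}^2$ that is a convex polygon with $k$ vertices, all in $P$, in some Euclidean plane. A projective $k$-hole in $P$ ($k\ge3$) is a projective $k$-gon determined by $P$ with no point of $P$ in its interior; a projective hole is a projective $k$-hole for some $k\ge3$. The constants implied in $O(\cdot)$ and $\Omega(\cdot)$ are absolute (independent of $n$ and $x$), with the usual asymptotic understanding that $n$ is sufficiently large. *)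

theory Defs
  imports "HOL-Analysis.Analysis"
begin

definition general_position :: "(real^2) set \<Rightarrow> bool" where
  "general_position S \<longleftrightarrow> (\<forall>T \<subseteq> S. card T = 3 \<longrightarrow> \<not> collinear T)"

text \<open>A polytope in the plane with at least three vertices is a nondegenerate convex polygon.
  Holes are counted as subsets of the plane.\<close>

definition convex_polygon :: "nat \<Rightarrow> (real^2) set \<Rightarrow> bool" where
  "convex_polygon k H \<longleftrightarrow> 3 \<le> k \<and> polytope H \<and> card {v. v extreme_point_of H} = k"

definition affine_k_hole :: "nat \<Rightarrow> (real^2) set \<Rightarrow> (real^2) set \<Rightarrow> bool" where
  "affine_k_hole k S H \<longleftrightarrow>
     convex_polygon k H \<and> {v. v extreme_point_of H} \<subseteq> S \<and> interior H \<inter> S = {}"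

definition affine_holes :: "(real^2) set \<Rightarrow> (real^2) set set" where
  "affine_holes S = {H. \<exists>k \<ge> 3. affine_k_hole k S H}"

text \<open>Hence \<open>card (affine_holes S)\<close> is the actual number of affine holes of a finite set.\<close>

lemma finite_affine_holes:
  assumes "finite S"
  shows "finite (affine_holes S)"
proof (rule finite_subset)
  show "affine_holes S \<subseteq> (\<lambda>V. convex hull V) ` Pow S"
  proof
    fix H assume "H \<in> affine_holes S"
    then have "polytope H" and V: "{v. v extreme_point_of H} \<subseteq> S"
      by (auto simp: affine_holes_def affine_k_hole_def convex_polygon_def)
    then have "H = convex hull {v. v extreme_point_of H}"
      by (intro Krein_Milman_Minkowski polytope_imp_compact polytope_imp_convex)
    with V show "H \<in> (\<lambda>V. convex hull V) ` Pow S" by blast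
  qed
  show "finite ((\<lambda>V. convex hull V) ` Pow S)" using assms by simp
qed

typedef rp2 = "{L :: (real^3) set. subspace L \<and> dim L = 1}"
proof -
  have "dim (span {axis 1 1 :: real^3}) = 1"
    by (simp add: dim_span axis_eq_0_iff)
  then show ?thesis
    using subspace_span by blast
qed

text \<open>The point with homogeneous coordinates \<open>v\<close>; meaningful only for \<open>v \<noteq> 0\<close>.\<close>

definition proj_pt :: "real^3 \<Rightarrow> rp2" where
  "proj_pt v = Abs_rp2 (span {v})"

text \<open>The quotient topology of \<open>\<real>\<^sup>3\<close> without the origin.\<close>

instantiation rp2 :: topological_space
begin

definition open_rp2 :: "rp2 set \<Rightarrow> bool" where
  "open_rp2 U \<longleftrightarrow> open {v. v \<noteq> 0 \<and> proj_pt v \<in> U}"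

instance
proof
  have "{v :: real^3. v \<noteq> 0 \<and> proj_pt v \<in> UNIV} = - {0}" by auto
  then show "open (UNIV :: rp2 set)"
    by (simp add: open_rp2_def open_Compl)
next
  fix S T :: "rp2 set"
  assume "open S" "open T"
  moreover have "{v. v \<noteq> 0 \<and> proj_pt v \<in> S \<inter> T} =
      {v. v \<noteq> 0 \<and> proj_pt v \<in> S} \<inter> {v. v \<noteq> 0 \<and> proj_pt v \<in> T}" by auto
  ultimately show "open (S \<inter> T)"
    by (simp only: open_rp2_def open_Int)
next
  fix K :: "rp2 set set"
  assume "\<forall>S\<in>K. open S"
  moreover have "{v. v \<noteq> 0 \<and> proj_pt v \<in> \<Union>K} = (\<Union>S\<in>K. {v. v \<noteq> 0 \<and> proj_pt v \<in> S})" by auto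
  ultimately show "open (\<Union>K)"
    by (simp only: open_rp2_def open_UN)
qed

end

text \<open>The standard inclusion of the affine plane, \<open>(a, b) \<mapsto> [a : b : 1]\<close>.\<close>

definition embed_plane :: "real^2 \<Rightarrow> rp2" where
  "embed_plane p = proj_pt (vector [p $ 1, p $ 2, 1])"

definition proj_line :: "rp2 set \<Rightarrow> bool" where
  "proj_line l \<longleftrightarrow> (\<exists>W. subspace W \<and> dim W = 2 \<and> l = {p. Rep_rp2 p \<subseteq> W})"

definition euclidean_plane :: "rp2 set \<Rightarrow> bool" where
  "euclidean_plane \<rho> \<longleftrightarrow> (\<exists>l. proj_line l \<and> \<rho> = - l)"

text \<open>For \<open>p \<noteq> q\<close> the condition on \<open>0\<close> only says that \<open>u\<close> and \<open>v\<close> are nonzero; the choice of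
  their relative sign yields the two segments into which \<open>p\<close> and \<open>q\<close> divide the projective line
  through them.  For \<open>p = q\<close> the only segment is \<open>{p}\<close>.\<close>

definition proj_segment :: "rp2 \<Rightarrow> rp2 \<Rightarrow> rp2 set \<Rightarrow> bool" where
  "proj_segment p q s \<longleftrightarrow>
     (\<exists>u v. 0 \<notin> closed_segment u v \<and> p = proj_pt u \<and> q = proj_pt v \<and>
            s = proj_pt ` closed_segment u v)"

definition semiconvex :: "rp2 set \<Rightarrow> bool" where
  "semiconvex X \<longleftrightarrow> (\<forall>p\<in>X. \<forall>q\<in>X. \<exists>s. proj_segment p q s \<and> s \<subseteq> X)"

definition proj_convex :: "rp2 set \<Rightarrow> bool" where
  "proj_convex X \<longleftrightarrow> semiconvex X \<and> (\<exists>\<rho>. euclidean_plane \<rho> \<and> X \<subseteq> \<rho>)"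

definition proj_convex_hull :: "rp2 set \<Rightarrow> rp2 set \<Rightarrow> bool" where
  "proj_convex_hull Y X \<longleftrightarrow>
     proj_convex X \<and> Y \<subseteq> X \<and> (\<forall>Z. proj_convex Z \<and> Y \<subseteq> Z \<and> Z \<subseteq> X \<longrightarrow> Z = X)"

definition proj_k_gon :: "nat \<Rightarrow> rp2 set \<Rightarrow> rp2 set \<Rightarrow> bool" where
  "proj_k_gon k P X \<longleftrightarrow>
     (\<exists>G \<subseteq> P. finite G \<and> card G = k \<and> proj_convex_hull G X \<and> G \<subseteq> frontier X)"

definition proj_k_hole :: "nat \<Rightarrow> rp2 set \<Rightarrow> rp2 set \<Rightarrow> bool" where
  "proj_k_hole k P X \<longleftrightarrow> 3 \<le> k \<and> proj_k_gon k P X \<and> interior X \<inter> P = {}"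

definition proj_holes :: "rp2 set \<Rightarrow> rp2 set set" where
  "proj_holes P = {X. \<exists>k \<ge> 3. proj_k_hole k P X}"

end

theory Submission
  imports Defs
begin

text \<open>Take \<open>m\<close> points on each branch of the hyperbola \<open>x * y = 1\<close>, where \<open>2 ^ m\<close> is about \<open>x\<close>.
  In the projective plane the hyperbola is a convex curve, so each of the roughly \<open>2 ^ (2 * m)\<close>
  subsets with at least three points spans a projective hole inside this curve
  (\<open>card_proj_holes_ge\<close>).  In the affine plane, however, each branch bulges towards the other one:
  if a hole has a vertex on one branch, it has at most two vertices on the other
  (\<open>arc_vertices_le_2\<close>).  So apart from the \<open>2 * 2 ^ m\<close> holes within a single branch, the
  two arcs determine only polynomially many affine holes in \<open>m\<close>.

  The remaining \<open>h = n - 2 * m\<close> points must have only \<open>O(h\<^sup>2)\<close> affine holes, stay out of the projective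
  holes, and create few holes together with the arcs.  They form a Horton set, whose holes number
  at most \<open>8 * h\<^sup>2\<close> (\<open>card_hole_sets_horton\<close>).  The set is tiny, so near the origin that the arcs still
  bulge towards it, and so flat that all lines through two of its points pass below both arcs
  (\<open>horton_near_origin\<close>).  A hole that uses both the cluster and the arcs then meets the cluster in a set
  that is open from above, of which there are at most \<open>4 * h\<close> (\<open>card_open_above\<close>), and meets each arc
  in at most two points.  The number of such holes is thus at most linear in \<open>h\<close> and
  polynomial in \<open>m\<close>, hence \<open>O(h\<^sup>2 + 2 ^ m)\<close>.

  The lower bound also requires that there are only finitely many projective holes
  (\<open>finite_proj_holes\<close>), and that the inscribed polygons are minimal convex sets.  Both follow by
  lifting projectively convex sets to convex cones in \<open>\<real>\<^sup>3\<close> (\<open>convex_lift\<close>).\<close>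

section \<open>Orientations and empty convex hulls\<close>

text \<open>Twice the signed area of the triangle \<open>p q r\<close>: positive iff \<open>r\<close> lies to the left of the
  directed line from \<open>p\<close> to \<open>q\<close>, zero iff the points are collinear.\<close>
definition orient :: "real^2 \<Rightarrow> real^2 \<Rightarrow> real^2 \<Rightarrow> real" where
  "orient p q r = (q$1 - p$1) * (r$2 - p$2) - (q$2 - p$2) * (r$1 - p$1)"

lemma orient_rotate: "orient q r p = orient p q r"
  by (simp add: orient_def algebra_simps)

lemma orient_swap: "orient q p r = - orient p q r"
  by (simp add: orient_def algebra_simps)

lemma orient_uminus [simp]: "orient (- p) (- q) (- r) = orient p q r"
  by (simp add: orient_def algebra_simps)

lemma orient_zero_perm:
  "orient p r q = 0 \<longleftrightarrow> orient p q r = 0" "orient q p r = 0 \<longleftrightarrow> orient p q r = 0"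
  "orient q r p = 0 \<longleftrightarrow> orient p q r = 0" "orient r p q = 0 \<longleftrightarrow> orient p q r = 0"
  "orient r q p = 0 \<longleftrightarrow> orient p q r = 0"
  by (auto simp: orient_def algebra_simps)

lemma collinear_imp_orient_zero:
  assumes "collinear {p, q, r}"
  shows "orient p q r = 0"
proof -
  obtain u where u: "\<And>x y. x \<in> {p,q,r} \<Longrightarrow> y \<in> {p,q,r} \<Longrightarrow> \<exists>c. x - y = c *\<^sub>R u"
    using assms unfolding collinear_def by blast
  obtain c where c: "q - p = c *\<^sub>R u" using u[of q p] by auto
  obtain d where d: "r - p = d *\<^sub>R u" using u[of r p] by auto
  have "orient p q r = (q - p)$1 * (r - p)$2 - (q - p)$2 * (r - p)$1"
    by (simp add: orient_def)
  then show ?thesis by (simp add: c d)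
qed

definition no_three_collinear :: "(real^2) set \<Rightarrow> bool" where
  "no_three_collinear P \<longleftrightarrow>
     (\<forall>p\<in>P. \<forall>q\<in>P. \<forall>r\<in>P. p \<noteq> q \<and> p \<noteq> r \<and> q \<noteq> r \<longrightarrow> orient p q r \<noteq> 0)"

lemma no_three_collinear_imp_general_position:
  assumes "no_three_collinear P"
  shows "general_position P"
  unfolding general_position_def
proof (intro allI impI notI)
  fix T assume T: "T \<subseteq> P" "card T = 3" "collinear T"
  obtain p q r where pqr: "T = {p, q, r}" "p \<noteq> q" "p \<noteq> r" "q \<noteq> r"
    using T(2) by (auto simp: card_3_iff)
  then have "orient p q r = 0" using T(3) collinear_imp_orient_zero by auto
  with assms pqr T(1) show False by (auto simp: no_three_collinear_def)
qed

lemma no_three_collinear_Un: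
  assumes P: "no_three_collinear P" and Q: "no_three_collinear Q"
    and PPQ: "\<And>p p' q. p \<in> P \<Longrightarrow> p' \<in> P \<Longrightarrow> q \<in> Q \<Longrightarrow> p \<noteq> p' \<Longrightarrow> orient p p' q \<noteq> 0"
    and QQP: "\<And>q q' p. q \<in> Q \<Longrightarrow> q' \<in> Q \<Longrightarrow> p \<in> P \<Longrightarrow> q \<noteq> q' \<Longrightarrow> orient q q' p \<noteq> 0"
  shows "no_three_collinear (P \<union> Q)"
  unfolding no_three_collinear_def
proof (intro ballI impI)
  fix p q r assume pqr: "p \<in> P \<union> Q" "q \<in> P \<union> Q" "r \<in> P \<union> Q" "p \<noteq> q \<and> p \<noteq> r \<and> q \<noteq> r"
  have P': "orient a b c \<noteq> 0" if "a \<in> P" "b \<in> P" "c \<in> P" "a \<noteq> b" "a \<noteq> c" "b \<noteq> c" for a b c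
    using P that unfolding no_three_collinear_def by blast
  have Q': "orient a b c \<noteq> 0" if "a \<in> Q" "b \<in> Q" "c \<in> Q" "a \<noteq> b" "a \<noteq> c" "b \<noteq> c" for a b c
    using Q that unfolding no_three_collinear_def by blast
  show "orient p q r \<noteq> 0"
    using pqr P'[of p q r] Q'[of p q r] PPQ[of p q r] PPQ[of p r q] PPQ[of q r p]
      QQP[of p q r] QQP[of p r q] QQP[of q r p] orient_zero_perm[where p=p and q=q and r=r]
    by (elim UnE) simp_all
qed

lemma DIM_real2: "DIM(real^2) = 2"
  by simp

lemma in_interior_triangle:
  assumes "orient u w p > 0" "orient w t p > 0" "orient t u p > 0"
  shows "p \<in> interior (convex hull {u, w, t})"
proof -
  define D where "D = orient u w t"
  have D: "D = orient u w p + orient w t p + orient t u p"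
    by (simp add: D_def orient_def algebra_simps)
  then have pos: "D > 0" using assms by linarith
  have nc: "\<not> collinear {u, w, t}"
    using collinear_imp_orient_zero pos by (fastforce simp: D_def)
  define x where "x = orient w t p / D"
  define y where "y = orient t u p / D"
  define z where "z = orient u w p / D"
  have xyz: "x > 0" "y > 0" "z > 0" using assms pos by (auto simp: x_def y_def z_def)
  have sum: "x + y + z = 1"
    using pos D by (simp add: x_def y_def z_def add_divide_distrib[symmetric])
  have c: "D * p$i = orient w t p * u$i + orient t u p * w$i + orient u w p * t$i"
    if "i = 1 \<or> i = 2" for i
    using that by (auto simp: D_def orient_def algebra_simps)
  have "p$i = x * u$i + y * w$i + z * t$i" if "i = 1 \<or> i = 2" for i
    using c[OF that] pos by (simp add: x_def y_def z_def field_simps)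
  then have "x *\<^sub>R u + y *\<^sub>R w + z *\<^sub>R t = p"
    by (simp add: vec_eq_iff forall_2)
  then show ?thesis
    using xyz sum unfolding interior_convex_hull_3_minimal[OF nc DIM_real2] by blast
qed

text \<open>An affine hole is determined by its vertex set, so holes can be counted as subsets of \<open>S\<close>.
  Sets in \<open>hole_sets S\<close> need not be in convex position and may have fewer than three points; this
  only enlarges the count, and makes it a purely combinatorial one.\<close>
definition hole_sets :: "(real^2) set \<Rightarrow> (real^2) set set" where
  "hole_sets S = {V. V \<subseteq> S \<and> V \<noteq> {} \<and> interior (convex hull V) \<inter> S = {}}"

lemma hole_sets_finite: "finite S \<Longrightarrow> finite (hole_sets S)"
  by (rule finite_subset[of _ "Pow S"]) (auto simp: hole_sets_def)

text \<open>The only way in which emptiness is ever exploited: no point of \<open>S\<close>, vertices included, lies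
  strictly inside a triangle spanned by three vertices of the same hole.\<close>
lemma hole_sets_no_interior_triangle:
  assumes "V \<in> hole_sets S" "u \<in> V" "w \<in> V" "t \<in> V" "p \<in> S"
    and "orient u w p > 0" "orient w t p > 0" "orient t u p > 0"
  shows False
proof -
  have "convex hull {u, w, t} \<subseteq> convex hull V"
    using assms by (intro hull_mono) auto
  then have "p \<in> interior (convex hull V)"
    using in_interior_triangle[OF assms(6-8)] interior_mono by blast
  then show False using assms by (auto simp: hole_sets_def)
qed

lemma hole_sets_uminus:
  assumes "V \<in> hole_sets S"
  shows "uminus ` V \<in> hole_sets (uminus ` S)"
proof -
  have "interior (convex hull (uminus ` V)) = uminus ` interior (convex hull V)"
    by (metis convex_hull_linear_image interior_negations linear_uminus)
  then show ?thesis using assms by (auto simp: hole_sets_def)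
qed

lemma card_affine_holes_le:
  assumes "finite S"
  shows "card (affine_holes S) \<le> card (hole_sets S)"
proof (rule card_inj_on_le)
  have hull: "H = convex hull {v. v extreme_point_of H}" if "H \<in> affine_holes S" for H
    using that by (intro Krein_Milman_Minkowski polytope_imp_compact polytope_imp_convex)
      (auto simp: affine_holes_def affine_k_hole_def convex_polygon_def)
  show "inj_on (\<lambda>H. {v. v extreme_point_of H}) (affine_holes S)"
    using hull by (intro inj_onI) metis
  show "(\<lambda>H. {v. v extreme_point_of H}) ` affine_holes S \<subseteq> hole_sets S"
  proof safe
    fix H assume H: "H \<in> affine_holes S"
    then have "card {v. v extreme_point_of H} \<ge> 3" "{v. v extreme_point_of H} \<subseteq> S"
        "interior H \<inter> S = {}"
      by (auto simp: affine_holes_def affine_k_hole_def convex_polygon_def)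
    then show "{v. v extreme_point_of H} \<in> hole_sets S"
      using hull[OF H] by (auto simp: hole_sets_def)
  qed
qed (use assms hole_sets_finite in auto)

section \<open>Horton sets\<close>

text \<open>Every line through two points of \<open>P\<close> passes below all of \<open>Q\<close>.\<close>
definition far_below :: "(real^2) set \<Rightarrow> (real^2) set \<Rightarrow> bool" where
  "far_below P Q \<longleftrightarrow> (\<forall>p\<in>P. \<forall>p'\<in>P. \<forall>q\<in>Q. p$1 < p'$1 \<longrightarrow> orient p p' q > 0)"

definition separated_by :: "(real^2) set \<Rightarrow> (real^2) set \<Rightarrow> bool" where
  "separated_by P Q \<longleftrightarrow> (\<forall>p\<in>P. \<forall>p'\<in>P. p$1 < p'$1 \<longrightarrow> (\<exists>q\<in>Q. p$1 < q$1 \<and> q$1 < p'$1))"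

text \<open>A Horton set splits into two Horton sets, one far below the other, whose abscissae separate
  each other.  The condition that \<open>Q\<close> is far above \<open>P\<close> is expressed by a rotation by \<open>180\<close> degrees, so
  that it reuses \<open>far_below\<close>, and so that the class of Horton sets is visibly invariant under that
  rotation.\<close>
inductive horton :: "(real^2) set \<Rightarrow> bool" where
  empty: "horton {}"
| single: "horton {p}"
| join: "horton P \<Longrightarrow> horton Q \<Longrightarrow> far_below P Q \<Longrightarrow> far_below (uminus ` Q) (uminus ` P) \<Longrightarrow>
    separated_by P Q \<Longrightarrow> separated_by Q P \<Longrightarrow> inj_on (\<lambda>p. p$1) (P \<union> Q) \<Longrightarrow> P \<inter> Q = {} \<Longrightarrow>
    horton (P \<union> Q)"

lemma horton_finite: "horton P \<Longrightarrow> finite P"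
  by (induction rule: horton.induct) auto

lemma horton_inj: "horton P \<Longrightarrow> inj_on (\<lambda>p. p$1) P"
  by (induction rule: horton.induct) auto

lemma separated_by_uminus: "separated_by P Q \<Longrightarrow> separated_by (uminus ` P) (uminus ` Q)"
  by (fastforce simp: separated_by_def)

lemma horton_uminus: "horton P \<Longrightarrow> horton (uminus ` P)"
proof (induction rule: horton.induct)
  case (join P Q)
  have i: "inj_on (\<lambda>p. p$1) (uminus ` Q \<union> uminus ` P)"
    using join.hyps(7) by (auto simp: inj_on_def)
  have f: "far_below (uminus ` uminus ` P) (uminus ` uminus ` Q)"
    using join.hyps by (simp add: image_image)
  have "horton (uminus ` Q \<union> uminus ` P)"
    using join.IH(2,1) join.hyps(4) f separated_by_uminus[OF join.hyps(6)]
      separated_by_uminus[OF join.hyps(5)] i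
  proof (rule horton.join)
    show "uminus ` Q \<inter> uminus ` P = {}" using join.hyps(8) by auto
  qed
  then show ?case by (simp add: image_Un Un_commute)
qed (auto intro: horton.intros)

lemma far_belowD: "far_below P Q \<Longrightarrow> p \<in> P \<Longrightarrow> p' \<in> P \<Longrightarrow> q \<in> Q \<Longrightarrow> p$1 < p'$1 \<Longrightarrow> orient p p' q > 0"
  by (auto simp: far_below_def)

lemma far_below_uminusD:
  assumes "far_below (uminus ` Q) (uminus ` P)" "q \<in> Q" "q' \<in> Q" "p \<in> P" "q$1 < q'$1"
  shows "orient q q' p < 0"
proof -
  have "orient (- q') (- q) (- p) > 0"
    by (rule far_belowD[OF assms(1)]) (use assms in auto)
  then show ?thesis using orient_swap[of q q' p] by simp
qed

lemma far_below_noncollinear: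
  assumes "far_below P Q" "inj_on (\<lambda>p. p$1) P" "p \<in> P" "p' \<in> P" "q \<in> Q" "p \<noteq> p'"
  shows "orient p p' q \<noteq> 0"
proof -
  have "p$1 \<noteq> p'$1" using assms by (auto simp: inj_on_def)
  then consider "p$1 < p'$1" | "p'$1 < p$1" by linarith
  then show ?thesis
    using far_belowD[OF assms(1,3,4,5)] far_belowD[OF assms(1,4,3,5)] orient_swap[of p p' q]
    by cases auto
qed

lemma horton_no_three_collinear: "horton P \<Longrightarrow> no_three_collinear P"
proof (induction rule: horton.induct)
  case (join P Q)
  show ?case
  proof (rule no_three_collinear_Un[OF join.IH])
    show "orient p p' q \<noteq> 0" if "p \<in> P" "p' \<in> P" "q \<in> Q" "p \<noteq> p'" for p p' q
      using far_below_noncollinear[OF join.hyps(3)] join.hyps(7) that by (auto simp: inj_on_Un)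
    show "orient q q' p \<noteq> 0" if "q \<in> Q" "q' \<in> Q" "p \<in> P" "q \<noteq> q'" for p q q'
    proof -
      have "inj_on (\<lambda>p. p$1) (uminus ` Q)"
        using join.hyps(7) by (auto simp: inj_on_def)
      from far_below_noncollinear[OF join.hyps(4) this, of "- q" "- q'" "- p"] that
      show ?thesis by simp
    qed
  qed
qed (auto simp: no_three_collinear_def)

text \<open>This is what a hole that contains a point far above \<open>P\<close> can leave on \<open>P\<close>: no point of \<open>P\<close>
  lies above a chord of \<open>G\<close> and over it.  In particular \<open>G\<close> is convex from below.\<close>
definition open_above :: "(real^2) set \<Rightarrow> (real^2) set \<Rightarrow> bool" where
  "open_above P G \<longleftrightarrow> G \<subseteq> P \<and> G \<noteq> {} \<and>
     (\<forall>u\<in>G. \<forall>w\<in>G. \<forall>p\<in>P. u$1 < p$1 \<and> p$1 < w$1 \<longrightarrow> orient u w p \<le> 0)"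

lemma open_aboveD:
  "open_above P G \<Longrightarrow> u \<in> G \<Longrightarrow> w \<in> G \<Longrightarrow> p \<in> P \<Longrightarrow> u$1 < p$1 \<Longrightarrow> p$1 < w$1 \<Longrightarrow> orient u w p \<le> 0"
  by (auto simp: open_above_def)

lemma finite_open_above: "finite P \<Longrightarrow> finite {G. open_above P G}"
  by (rule finite_subset[of _ "Pow P"]) (auto simp: open_above_def)

text \<open>If \<open>p\<close> lies over the chord \<open>u w\<close> and \<open>t\<close> is above the lines \<open>u p\<close> and \<open>p w\<close>, then \<open>p\<close> lies
  inside the triangle \<open>u w t\<close>.\<close>
lemma hole_set_open_above:
  assumes V: "V \<in> hole_sets S" and "P \<subseteq> S" "V \<inter> P \<noteq> {}" and t: "t \<in> V" "t \<in> U"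
    and fb: "far_below P U"
  shows "open_above P (V \<inter> P)"
  unfolding open_above_def
proof (intro conjI ballI impI)
  fix u w p assume *: "u \<in> V \<inter> P" "w \<in> V \<inter> P" "p \<in> P" "u$1 < p$1 \<and> p$1 < w$1"
  show "orient u w p \<le> 0"
  proof (rule ccontr)
    assume "\<not> orient u w p \<le> 0"
    then have 1: "orient u w p > 0" by simp
    have 2: "orient p w t > 0" "orient u p t > 0"
      using * t by (auto intro!: far_belowD[OF fb])
    show False
      by (rule hole_sets_no_interior_triangle[OF V, of u w t p])
        (use * t 1 2 assms(2) orient_rotate in auto)
  qed
qed (use assms in auto)

lemma card_UN_le_mult:
  assumes "finite A" "\<And>a. a \<in> A \<Longrightarrow> card (F a) \<le> k"
  shows "card (\<Union>a\<in>A. F a) \<le> k * card A"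
proof -
  have "card (\<Union>a\<in>A. F a) \<le> (\<Sum>a\<in>A. card (F a))" by (rule card_UN_le[OF assms(1)])
  also have "\<dots> \<le> (\<Sum>a\<in>A. k)" by (rule sum_mono) (use assms in auto)
  finally show ?thesis by (simp add: mult.commute)
qed

text \<open>Let \<open>G\<close> be open above in \<open>P \<union> Q\<close> with \<open>P\<close> below \<open>Q\<close>.  Two points of \<open>G\<close> in \<open>P\<close> are impossible,
  since some point of \<open>Q\<close> lies between them and above their chord.  If \<open>G\<close> contains one point \<open>a\<close>
  of \<open>P\<close>, then a point \<open>b\<close> of \<open>G\<close> in \<open>Q\<close> must be a neighbour of \<open>a\<close> among the abscissae of \<open>Q\<close>: a
  point \<open>c\<close> of \<open>Q\<close> between \<open>a\<close> and \<open>b\<close> is above the chord \<open>a b\<close>, because \<open>a\<close> is below the line \<open>b c\<close>.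
  So each \<open>a\<close> admits at most four sets, and those within \<open>Q\<close> are counted by induction.\<close>
lemma card_open_above:
  "horton P \<Longrightarrow> card {G. open_above P G} \<le> 4 * card P"
proof (induction rule: horton.induct)
  case empty
  have "{G. open_above {} G} = {}" by (auto simp: open_above_def)
  then show ?case by simp
next
  case (single p)
  have "{G. open_above {p} G} \<subseteq> {{p}}" by (auto simp: open_above_def)
  then have "card {G. open_above {p} G} \<le> card {{p}}" by (rule card_mono[rotated]) simp
  then show ?case by simp
next
  case (join P Q)
  note far = far_belowD[OF join.hyps(3)] and far' = far_below_uminusD[OF join.hyps(4)]
  have fin: "finite P" "finite Q" using join.hyps horton_finite by auto
  note disj = join.hyps(8)
  have inj: "inj_on (\<lambda>p. p$1) Q" using join.hyps(7) by (simp add: inj_on_Un)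
  define next_right where "next_right a b \<longleftrightarrow> b \<in> Q \<and> a$1 < b$1 \<and> (\<forall>c\<in>Q. a$1 < c$1 \<longrightarrow> b$1 \<le> c$1)"
    for a b :: "real^2"
  define next_left where "next_left a b \<longleftrightarrow> b \<in> Q \<and> b$1 < a$1 \<and> (\<forall>c\<in>Q. c$1 < a$1 \<longrightarrow> c$1 \<le> b$1)"
    for a b :: "real^2"
  define r where "r a = (SOME b. next_right a b)" for a
  define l where "l a = (SOME b. next_left a b)" for a
  have r: "b = r a" if "next_right a b" for a b
  proof -
    have "next_right a (r a)" unfolding r_def using that by (rule someI)
    then have "b$1 = r a$1" "r a \<in> Q" "b \<in> Q" using that
      by (auto simp: next_right_def intro: antisym)
    then show ?thesis using inj by (auto simp: inj_on_def)
  qed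
  have l: "b = l a" if "next_left a b" for a b
  proof -
    have "next_left a (l a)" unfolding l_def using that by (rule someI)
    then have "b$1 = l a$1" "l a \<in> Q" "b \<in> Q" using that
      by (auto simp: next_left_def intro: antisym)
    then show ?thesis using inj by (auto simp: inj_on_def)
  qed
  have "{G. open_above (P \<union> Q) G} \<subseteq>
      {G. open_above Q G} \<union> (\<Union>a\<in>P. insert a ` Pow {l a, r a})"
  proof
    fix G assume "G \<in> {G. open_above (P \<union> Q) G}"
    then have G: "open_above (P \<union> Q) G" by simp
    then have GPQ: "G \<subseteq> P \<union> Q" by (simp add: open_above_def)
    show "G \<in> {G. open_above Q G} \<union> (\<Union>a\<in>P. insert a ` Pow {l a, r a})"
    proof (cases "G \<inter> P = {}")
      case True
      then have "open_above Q G" using G by (auto simp: open_above_def)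
      then show ?thesis by simp
    next
      case False
      then obtain a where a: "a \<in> G" "a \<in> P" by blast
      have no2: False if "u \<in> G" "w \<in> G" "u \<in> P" "w \<in> P" "u$1 < w$1" for u w
      proof -
        obtain q where q: "q \<in> Q" "u$1 < q$1" "q$1 < w$1"
          using join.hyps(5) \<open>u \<in> P\<close> \<open>w \<in> P\<close> \<open>u$1 < w$1\<close> unfolding separated_by_def by blast
        have "orient u w q > 0" using far that q by blast
        moreover have "orient u w q \<le> 0" by (rule open_aboveD[OF G]) (use that q in auto)
        ultimately show False by simp
      qed
      have uniq: "b = a" if "b \<in> G" "b \<in> P" for b
      proof -
        have "b$1 = a$1" using no2[of a b] no2[of b a] a that by fastforce
        then show ?thesis using join.hyps(7) a that by (auto simp: inj_on_def)
      qed
      have "b = l a \<or> b = r a" if b: "b \<in> G" "b \<in> Q" for b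
      proof -
        have "b$1 \<noteq> a$1" using join.hyps(7) a b disj by (fastforce simp: inj_on_def)
        then consider "a$1 < b$1" | "b$1 < a$1" by linarith
        then show ?thesis
        proof cases
          case 1
          have "b$1 \<le> c$1" if c: "c \<in> Q" "a$1 < c$1" for c
          proof (rule ccontr)
            assume "\<not> b$1 \<le> c$1"
            then have "orient c b a < 0" using far'[of c b a] a b c by simp
            moreover have "orient a b c \<le> 0"
              by (rule open_aboveD[OF G]) (use a b c \<open>\<not> b$1 \<le> c$1\<close> in auto)
            ultimately show False by (simp add: orient_def algebra_simps)
          qed
          then show ?thesis using r[of a b] 1 b by (auto simp: next_right_def)
        next
          case 2
          have "c$1 \<le> b$1" if c: "c \<in> Q" "c$1 < a$1" for c
          proof (rule ccontr)
            assume "\<not> c$1 \<le> b$1"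
            then have "orient b c a < 0" using far'[of b c a] a b c by simp
            moreover have "orient b a c \<le> 0"
              by (rule open_aboveD[OF G]) (use a b c \<open>\<not> c$1 \<le> b$1\<close> in auto)
            ultimately show False by (simp add: orient_def algebra_simps)
          qed
          then show ?thesis using l[of a b] 2 b by (auto simp: next_left_def)
        qed
      qed
      then have "G - {a} \<subseteq> {l a, r a}" using uniq GPQ by blast
      moreover have "G = insert a (G - {a})" using a by blast
      ultimately show ?thesis using a by blast
    qed
  qed
  then have "card {G. open_above (P \<union> Q) G} \<le>
      card ({G. open_above Q G} \<union> (\<Union>a\<in>P. insert a ` Pow {l a, r a}))"
    using fin by (intro card_mono) (auto intro: finite_open_above)
  also have "\<dots> \<le> card {G. open_above Q G} + card (\<Union>a\<in>P. insert a ` Pow {l a, r a})"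
    by (rule card_Un_le)
  also have "card (\<Union>a\<in>P. insert a ` Pow {l a, r a}) \<le> 4 * card P"
  proof (rule card_UN_le_mult[OF fin(1)])
    fix a
    have "card (insert a ` Pow {l a, r a}) \<le> card (Pow {l a, r a})" by (rule card_image_le) simp
    also have "\<dots> = 2 ^ card {l a, r a}" by (rule card_Pow) simp
    also have "\<dots> \<le> 2 ^ 2" by (rule power_increasing) (auto simp: card_insert_if)
    finally show "card (insert a ` Pow {l a, r a}) \<le> 4" by simp
  qed
  finally show ?case using join.IH fin disj by (simp add: card_Un_disjoint)
qed

text \<open>A hole with vertices in both halves leaves a set that is open above on the lower half and one
  that is open below on the upper half.  So there are at most \<open>16 * card P * card Q\<close> of them, which
  is exactly the cross term of \<open>8 * (card P + card Q)\<^sup>2\<close>; hence the induction closes without any balance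
  between the halves.\<close>
lemma card_hole_sets_horton:
  "horton P \<Longrightarrow> card (hole_sets P) \<le> 8 * (card P)\<^sup>2"
proof (induction rule: horton.induct)
  case empty
  have "hole_sets {} = {}" by (auto simp: hole_sets_def)
  then show ?case by simp
next
  case (single p)
  have "hole_sets {p} \<subseteq> {{p}}" by (auto simp: hole_sets_def)
  then have "card (hole_sets {p}) \<le> card {{p}}" by (rule card_mono[rotated]) simp
  then show ?case by simp
next
  case (join P Q)
  have fin: "finite P" "finite Q" using join.hyps horton_finite by auto
  define A where "A = {G. open_above P G}"
  define B where "B = (\<lambda>G. uminus ` G) ` {G. open_above (uminus ` Q) G}"
  have finAB: "finite A" "finite B"
    using fin finite_open_above by (auto simp: A_def B_def)
  have A: "card A \<le> 4 * card P" unfolding A_def by (rule card_open_above[OF join.hyps(1)])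
  have "card B \<le> card {G. open_above (uminus ` Q) G}"
    unfolding B_def using fin by (intro card_image_le finite_open_above) auto
  also have "\<dots> \<le> 4 * card (uminus ` Q)"
    by (rule card_open_above[OF horton_uminus[OF join.hyps(2)]])
  also have "card (uminus ` Q) = card Q" by (rule card_image) simp
  finally have B: "card B \<le> 4 * card Q" .
  have "hole_sets (P \<union> Q) \<subseteq> hole_sets P \<union> hole_sets Q \<union> (\<lambda>(X, Y). X \<union> Y) ` (A \<times> B)"
  proof
    fix V assume V: "V \<in> hole_sets (P \<union> Q)"
    then have sub: "V \<subseteq> P \<union> Q" by (auto simp: hole_sets_def)
    consider "V \<subseteq> P" | "V \<subseteq> Q" | "V \<inter> P \<noteq> {}" "V \<inter> Q \<noteq> {}" using sub by blast
    then show "V \<in> hole_sets P \<union> hole_sets Q \<union> (\<lambda>(X, Y). X \<union> Y) ` (A \<times> B)"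
    proof cases
      case 3
      obtain p q where p: "p \<in> V" "p \<in> P" and q: "q \<in> V" "q \<in> Q" using 3 by blast
      have "V \<inter> P \<in> A"
        using hole_set_open_above[OF V _ 3(1) q join.hyps(3)] by (simp add: A_def)
      moreover have "open_above (uminus ` Q) (uminus ` V \<inter> uminus ` Q)"
      proof (rule hole_set_open_above[OF hole_sets_uminus[OF V] _ _ _ _ join.hyps(4)])
        show "- p \<in> uminus ` V" "- p \<in> uminus ` P" using p by auto
      qed (use q in auto)
      then have "V \<inter> Q \<in> B"
        unfolding B_def by (intro image_eqI[of _ _ "uminus ` V \<inter> uminus ` Q"]) force+
      moreover have "V = (V \<inter> P) \<union> (V \<inter> Q)" using sub by blast
      ultimately show ?thesis by (auto intro!: image_eqI[of _ _ "(V \<inter> P, V \<inter> Q)"])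
    qed (use V in \<open>auto simp: hole_sets_def\<close>)
  qed
  then have "card (hole_sets (P \<union> Q)) \<le>
      card (hole_sets P \<union> hole_sets Q \<union> (\<lambda>(X, Y). X \<union> Y) ` (A \<times> B))"
    using fin finAB hole_sets_finite by (intro card_mono) auto
  also have "\<dots> \<le> card (hole_sets P) + card (hole_sets Q) + card ((\<lambda>(X, Y). X \<union> Y) ` (A \<times> B))"
    by (meson add_le_mono card_Un_le le_trans order_refl)
  also have "card ((\<lambda>(X, Y). X \<union> Y) ` (A \<times> B)) \<le> card A * card B"
    using card_image_le[of "A \<times> B" "\<lambda>(X, Y). X \<union> Y"] finAB by (simp add: card_cartesian_product)
  also have "\<dots> \<le> (4 * card P) * (4 * card Q)" using A B by (rule mult_le_mono)
  finally have "card (hole_sets (P \<union> Q)) \<le> 8 * (card P)\<^sup>2 + 8 * (card Q)\<^sup>2 + (4 * card P) * (4 * card Q)"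
    using join.IH by linarith
  also have "\<dots> = 8 * (card (P \<union> Q))\<^sup>2"
    using fin join.hyps(8) by (simp add: card_Un_disjoint power2_eq_square algebra_simps)
  finally show ?case .
qed

text \<open>The affine maps that keep vertical lines vertical; for \<open>c, \<beta> > 0\<close> they preserve both the order of
  the abscissae and all orientations, and therefore Horton sets.\<close>
definition shear :: "real \<Rightarrow> real \<Rightarrow> real \<Rightarrow> real \<Rightarrow> real \<Rightarrow> real^2 \<Rightarrow> real^2" where
  "shear c d \<alpha> \<beta> \<gamma> p = vector [c * p$1 + d, \<alpha> * p$1 + \<beta> * p$2 + \<gamma>]"

lemma shear_nth [simp]:
  "shear c d \<alpha> \<beta> \<gamma> p $ 1 = c * p$1 + d" "shear c d \<alpha> \<beta> \<gamma> p $ 2 = \<alpha> * p$1 + \<beta> * p$2 + \<gamma>"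
  by (simp_all add: shear_def)

lemma orient_shear:
  "orient (shear c d \<alpha> \<beta> \<gamma> p) (shear c d \<alpha> \<beta> \<gamma> q) (shear c d \<alpha> \<beta> \<gamma> r) = c * \<beta> * orient p q r"
  by (simp add: orient_def algebra_simps)

lemma horton_shear:
  assumes "horton P" "c > 0" "\<beta> > 0"
  shows "horton (shear c d \<alpha> \<beta> \<gamma> ` P)"
  using assms(1)
proof (induction rule: horton.induct)
  case (join P Q)
  let ?T = "shear c d \<alpha> \<beta> \<gamma>"
  have x: "?T p $ 1 < ?T q $ 1 \<longleftrightarrow> p$1 < q$1" for p q using assms(2) by simp
  have far: "far_below (?T ` P) (?T ` Q)" unfolding far_below_def
  proof (intro ballI impI)
    fix p p' q assume *: "p \<in> ?T ` P" "p' \<in> ?T ` P" "q \<in> ?T ` Q" "p$1 < p'$1"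
    then obtain a a' b where ab: "a \<in> P" "a' \<in> P" "b \<in> Q" "p = ?T a" "p' = ?T a'" "q = ?T b"
      by blast
    then have "orient a a' b > 0" using far_belowD[OF join.hyps(3)] * x by blast
    then show "orient p p' q > 0" using ab assms by (simp add: orient_shear)
  qed
  have far': "far_below (uminus ` ?T ` Q) (uminus ` ?T ` P)" unfolding far_below_def
  proof (intro ballI impI)
    fix q q' p assume *: "q \<in> uminus ` ?T ` Q" "q' \<in> uminus ` ?T ` Q" "p \<in> uminus ` ?T ` P"
      "q$1 < q'$1"
    then obtain b b' a where ab: "b \<in> Q" "b' \<in> Q" "a \<in> P" "q = - ?T b" "q' = - ?T b'" "p = - ?T a"
      by blast
    then have "orient b' b a < 0"
      using far_below_uminusD[OF join.hyps(4), of b' b a] * x[of b' b] by simp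
    then have "orient b b' a > 0" using orient_swap[of b b' a] by simp
    then show "orient q q' p > 0" using ab assms by (simp add: orient_shear)
  qed
  have sep: "separated_by (?T ` A) (?T ` B)" if "separated_by A B" for A B
    using that x unfolding separated_by_def ball_simps bex_simps by (metis)
  have inj: "inj_on (\<lambda>p. p$1) (?T ` P \<union> ?T ` Q)"
    unfolding image_Un[symmetric]
    using join.hyps(7) assms(2) by (intro inj_on_imageI) (auto simp: inj_on_def)
  have disj: "?T ` P \<inter> ?T ` Q = {}"
  proof (rule ccontr)
    assume "?T ` P \<inter> ?T ` Q \<noteq> {}"
    then obtain a b where ab: "a \<in> P" "b \<in> Q" "?T a = ?T b" by blast
    have "?T a $ 1 = ?T b $ 1" by (simp only: ab(3))
    then have "a$1 = b$1" using assms(2) by simp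
    then have "a = b" using join.hyps(7) ab by (auto simp: inj_on_def)
    then show False using join.hyps(8) ab by blast
  qed
  have "horton (?T ` P \<union> ?T ` Q)"
    using join.IH far far' sep[OF join.hyps(5)] sep[OF join.hyps(6)] inj disj by (rule horton.join)
  then show ?case by (simp add: image_Un)
qed (auto intro: horton.intros)

text \<open>Raising \<open>Q\<close> sufficiently puts it above the finitely many non-vertical lines through two points
  of \<open>P\<close>.\<close>
lemma eventually_far_below:
  assumes "finite P" "finite Q"
  shows "\<forall>\<^sub>F M in at_top. far_below P (shear 1 0 0 1 M ` Q)"
proof -
  have "\<forall>\<^sub>F M in at_top. p$1 < p'$1 \<longrightarrow> orient p p' (shear 1 0 0 1 M q) > 0" for p p' q :: "real^2"
  proof (cases "p$1 < p'$1")
    case True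
    have eq: "orient p p' (shear 1 0 0 1 M q) = orient p p' q + (p'$1 - p$1) * M" for M
      by (simp add: orient_def algebra_simps)
    show ?thesis unfolding eq
      using eventually_gt_at_top[of "- orient p p' q / (p'$1 - p$1)"]
    proof eventually_elim
      case (elim M)
      then show ?case using True by (simp add: field_simps)
    qed
  qed simp
  then have "\<forall>\<^sub>F M in at_top. \<forall>p\<in>P. \<forall>p'\<in>P. \<forall>q\<in>Q. p$1 < p'$1 \<longrightarrow> orient p p' (shear 1 0 0 1 M q) > 0"
    using assms by (simp add: eventually_ball_finite_distrib)
  then show ?thesis by eventually_elim (auto simp: far_below_def)
qed

text \<open>Place one Horton set on the even abscissae and another, lifted high enough, on the odd ones.\<close>
lemma horton_exists:
  "\<exists>P. horton P \<and> (\<lambda>p. p$1) ` P = real ` {..<n}"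
proof (induction n rule: less_induct)
  case (less n)
  show ?case
  proof (cases "n < 2")
    case True
    then consider "n = 0" | "n = 1" by linarith
    then show ?thesis
    proof cases
      case 1
      then show ?thesis using horton.empty by (intro exI[of _ "{}"]) auto
    next
      case 2
      then show ?thesis using horton.single[of 0] by (intro exI[of _ "{0}"]) auto
    qed
  next
    case False
    define k where "k = n - n div 2"
    define l where "l = n div 2"
    have kl: "k < n" "l < n" using False by (auto simp: k_def l_def)
    obtain P Q where P: "horton P" "(\<lambda>p. p$1) ` P = real ` {..<k}"
      and Q: "horton Q" "(\<lambda>p. p$1) ` Q = real ` {..<l}"
      using less.IH kl by metis
    define P' where "P' = shear 2 0 0 1 0 ` P"
    define Q' where "Q' = shear 2 1 0 1 0 ` Q"
    have hP: "horton P'" and hQ: "horton Q'"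
      using P Q by (auto simp: P'_def Q'_def intro: horton_shear)
    have ev: "\<forall>\<^sub>F M in at_top. far_below P' (shear 1 0 0 1 M ` Q')"
        "\<forall>\<^sub>F M in at_top. far_below (uminus ` Q') (shear 1 0 0 1 M ` (uminus ` P'))"
      using hP hQ horton_finite by (auto intro!: eventually_far_below)
    obtain M where M: "far_below P' (shear 1 0 0 1 M ` Q')"
        "far_below (uminus ` Q') (shear 1 0 0 1 M ` (uminus ` P'))"
      using eventually_happens[OF eventually_conj[OF ev]] by auto
    define R where "R = shear 1 0 0 1 M ` Q'"
    have hR: "horton R" using hQ by (auto simp: R_def intro: horton_shear)
    have far1: "far_below P' R" using M by (simp add: R_def)
    have far2: "far_below (uminus ` R) (uminus ` P')" unfolding far_below_def
    proof (intro ballI impI)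
      fix r r' p assume *: "r \<in> uminus ` R" "r' \<in> uminus ` R" "p \<in> uminus ` P'" "r$1 < r'$1"
      obtain q q' where q: "q \<in> Q'" "q' \<in> Q'" "r = - shear 1 0 0 1 M q" "r' = - shear 1 0 0 1 M q'"
        using * by (auto simp: R_def)
      have "orient (- q) (- q') (shear 1 0 0 1 M p) > 0"
        using q * by (intro far_belowD[OF M(2)]) auto
      then show "orient r r' p > 0" using q by (simp add: orient_def algebra_simps)
    qed
    have xP: "(\<lambda>p. p$1) ` P' = (\<lambda>i. real (2 * i)) ` {..<k}"
    proof -
      have "(\<lambda>p. p$1) ` P' = (\<lambda>x. 2 * x) ` (\<lambda>p. p$1) ` P" by (simp add: P'_def image_image)
      then show ?thesis by (simp add: P image_image)
    qed
    have xR: "(\<lambda>p. p$1) ` R = (\<lambda>i. real (2 * i + 1)) ` {..<l}"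
    proof -
      have "(\<lambda>p. p$1) ` R = (\<lambda>x. 2 * x + 1) ` (\<lambda>p. p$1) ` Q"
        by (simp add: R_def Q'_def image_image)
      then show ?thesis by (simp add: Q image_image add.commute)
    qed
    have P'x: "\<exists>i<k. p$1 = real (2 * i)" if "p \<in> P'" for p
      using that xP by blast
    have Rx: "\<exists>i<l. p$1 = real (2 * i + 1)" if "p \<in> R" for p
      using that xR by blast
    have P'ex: "\<exists>p\<in>P'. p$1 = real (2 * i)" if "i < k" for i
      using that xP by (metis (no_types, lifting) imageE imageI lessThan_iff)
    have Rex: "\<exists>p\<in>R. p$1 = real (2 * i + 1)" if "i < l" for i
      using that xR by (metis (no_types, lifting) imageE imageI lessThan_iff)
    have sep1: "separated_by P' R" unfolding separated_by_def
    proof (intro ballI impI)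
      fix p p' assume *: "p \<in> P'" "p' \<in> P'" "p$1 < p'$1"
      obtain i j where ij: "i < k" "p$1 = real (2 * i)" "j < k" "p'$1 = real (2 * j)"
        using P'x * by metis
      have "i < j" using ij * by simp
      then have "i < l" using ij by (simp add: k_def l_def)
      then obtain r where "r \<in> R" "r$1 = real (2 * i + 1)" using Rex by blast
      then show "\<exists>q\<in>R. p$1 < q$1 \<and> q$1 < p'$1"
        using ij \<open>i < j\<close> by (intro bexI[of _ r]) auto
    qed
    have sep2: "separated_by R P'" unfolding separated_by_def
    proof (intro ballI impI)
      fix p p' assume *: "p \<in> R" "p' \<in> R" "p$1 < p'$1"
      obtain i j where ij: "i < l" "p$1 = real (2 * i + 1)" "j < l" "p'$1 = real (2 * j + 1)"
        using Rx * by metis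
      have "i < j" using ij * by simp
      then have "i + 1 < k" using ij by (simp add: k_def l_def)
      then obtain r where "r \<in> P'" "r$1 = real (2 * (i + 1))" using P'ex by blast
      then show "\<exists>q\<in>P'. p$1 < q$1 \<and> q$1 < p'$1"
        using ij \<open>i < j\<close> by (intro bexI[of _ r]) auto
    qed
    have parity: "p$1 \<noteq> r$1" if pr: "p \<in> P'" "r \<in> R" for p r
    proof
      assume eq: "p$1 = r$1"
      obtain i j where "p$1 = real (2 * i)" "r$1 = real (2 * j + 1)"
        using P'x[OF pr(1)] Rx[OF pr(2)] by blast
      then have "2 * i = 2 * j + 1" using eq by linarith
      then show False by presburger
    qed
    have inj: "inj_on (\<lambda>p. p$1) (P' \<union> R)"
      using horton_inj[OF hP] horton_inj[OF hR] parity unfolding inj_on_Un by blast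
    have disj: "P' \<inter> R = {}" using parity by blast
    have "horton (P' \<union> R)"
      using hP hR far1 far2 sep1 sep2 inj disj by (rule horton.join)
    moreover have "(\<lambda>p. p$1) ` (P' \<union> R) = real ` {..<n}"
    proof -
      have "(\<lambda>i. 2 * i) ` {..<k} \<union> (\<lambda>i. 2 * i + 1) ` {..<l} = {..<n}"
      proof (intro equalityI subsetI)
        fix i assume i: "i \<in> {..<n}"
        show "i \<in> (\<lambda>i. 2 * i) ` {..<k} \<union> (\<lambda>i. 2 * i + 1) ` {..<l}"
        proof (cases "even i")
          case True
          then obtain j where "i = 2 * j" by blast
          then show ?thesis using i by (auto simp: k_def)
        next
          case False
          then obtain j where "i = 2 * j + 1" using oddE by blast
          then show ?thesis using i by (auto simp: l_def)
        qed
      qed (auto simp: k_def l_def)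
      then have "real ` {..<n} = real ` (\<lambda>i. 2 * i) ` {..<k} \<union> real ` (\<lambda>i. 2 * i + 1) ` {..<l}"
        by (metis image_Un)
      then show ?thesis by (simp only: image_Un xP xR image_image)
    qed
    ultimately show ?thesis by blast
  qed
qed

section \<open>Convexity in the projective plane\<close>

lemma Rep_proj_pt: "v \<noteq> 0 \<Longrightarrow> Rep_rp2 (proj_pt v) = span {v}"
  unfolding proj_pt_def by (rule Abs_rp2_inverse) (simp add: subspace_span dim_span)

lemma proj_pt_scale: "c \<noteq> 0 \<Longrightarrow> proj_pt (c *\<^sub>R v) = proj_pt v"
proof -
  assume "c \<noteq> 0"
  then have "span {c *\<^sub>R v} = span {v}" by (auto simp: span_singleton intro: rangeI)
      (metis (no_types, lifting) rangeI real_vector.scale_scale nonzero_divide_eq_eq)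
  then show ?thesis by (simp add: proj_pt_def)
qed

lemma proj_pt_eqD:
  assumes "proj_pt u = proj_pt v" "u \<noteq> 0" "v \<noteq> 0"
  shows "\<exists>c. c \<noteq> 0 \<and> u = c *\<^sub>R v"
proof -
  have "span {u} = span {v}" using assms Rep_proj_pt by metis
  then have "u \<in> span {v}" using span_base by blast
  then show ?thesis using assms(2) by (auto simp: span_singleton)
qed

lemma proj_pt_surj: obtains v where "v \<noteq> 0" "proj_pt v = p"
proof -
  have "Rep_rp2 p \<in> {L. subspace L \<and> dim L = 1}" by (rule Rep_rp2)
  then have L: "subspace (Rep_rp2 p)" "dim (Rep_rp2 p) = 1" by auto
  then obtain v where v: "v \<in> Rep_rp2 p" "v \<noteq> 0"
    by (metis dim_eq_0 insertCI subsetI zero_neq_one)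
  have "span {v} = Rep_rp2 p"
    by (rule subspace_dim_equal) (use L v span_minimal[of "{v}"] in \<open>auto simp: dim_span\<close>)
  then have "proj_pt v = p" unfolding proj_pt_def by (simp add: Rep_rp2_inverse)
  with v that show thesis by blast
qed

text \<open>The set \<open>X\<close> avoids the projective line with normal vector \<open>n\<close>, that is, it lies in the Euclidean
  plane obtained by removing that line.\<close>
definition off_line :: "real^3 \<Rightarrow> rp2 set \<Rightarrow> bool" where
  "off_line n X \<longleftrightarrow> n \<noteq> 0 \<and> (\<forall>v. v \<noteq> 0 \<and> proj_pt v \<in> X \<longrightarrow> n \<bullet> v \<noteq> 0)"

lemma off_line_in_euclidean_plane:
  assumes "off_line n X"
  shows "\<exists>\<rho>. euclidean_plane \<rho> \<and> X \<subseteq> \<rho>"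
proof -
  let ?W = "{v. n \<bullet> v = 0}"
  let ?l = "{p. Rep_rp2 p \<subseteq> ?W}"
  have "dim ?W = 2" using assms by (simp add: off_line_def dim_hyperplane)
  then have "proj_line ?l" unfolding proj_line_def
    by (intro exI[of _ ?W]) (simp add: subspace_hyperplane)
  moreover have "X \<subseteq> - ?l"
  proof
    fix p assume "p \<in> X"
    obtain v where v: "v \<noteq> 0" "proj_pt v = p" by (rule proj_pt_surj)
    then have "n \<bullet> v \<noteq> 0" using assms \<open>p \<in> X\<close> by (auto simp: off_line_def)
    moreover have "v \<in> Rep_rp2 p" using v Rep_proj_pt span_base by blast
    ultimately show "p \<in> - ?l" by auto
  qed
  ultimately show ?thesis unfolding euclidean_plane_def by blast
qed

lemma in_euclidean_plane_off_line:
  assumes "euclidean_plane \<rho>" "X \<subseteq> \<rho>"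
  shows "\<exists>n. off_line n X"
proof -
  obtain W where W: "subspace W" "dim W = 2" "\<rho> = - {p. Rep_rp2 p \<subseteq> W}"
    using assms unfolding euclidean_plane_def proj_line_def by blast
  obtain n :: "real^3" where n: "n \<noteq> 0" "span W \<subseteq> {x. n \<bullet> x = 0}"
    using lowdim_subset_hyperplane[of W] W(2) by auto
  have "W = {x. n \<bullet> x = 0}"
    by (rule subspace_dim_equal)
      (use W n span_superset in \<open>auto simp: dim_hyperplane subspace_hyperplane\<close>)
  then have "off_line n X" unfolding off_line_def
  proof (intro conjI allI impI notI)
    fix v assume "v \<noteq> 0 \<and> proj_pt v \<in> X" "n \<bullet> v = 0"
    then have "v \<in> W" "Rep_rp2 (proj_pt v) = span {v}" "proj_pt v \<in> \<rho>"
      using \<open>W = _\<close> Rep_proj_pt assms by auto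
    then show False using W span_minimal[of "{v}" W] by auto
  qed (use n in auto)
  then show ?thesis ..
qed

text \<open>Choosing for each point of \<open>X\<close> the representatives on the positive side of \<open>n\<close> gives a cone in
  \<open>\<real>\<^sup>3\<close>; it turns projective convexity into ordinary convexity.\<close>
definition lift :: "real^3 \<Rightarrow> rp2 set \<Rightarrow> (real^3) set" where
  "lift n X = {v. n \<bullet> v > 0 \<and> proj_pt v \<in> X}"

text \<open>A projective segment in \<open>X\<close> between two points lifts to one between some representatives
  \<open>a *\<^sub>R u\<close> and \<open>b *\<^sub>R v\<close>.  Since \<open>X\<close> misses the line, \<open>a\<close> and \<open>b\<close> have the same sign, and then the segment
  has the same projective points as the segment from \<open>u\<close> to \<open>v\<close>.\<close>
lemma convex_lift:
  assumes semi: "semiconvex X" and off: "off_line n X"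
  shows "convex (lift n X)"
  unfolding convex_alt
proof (intro ballI allI impI)
  fix u v t assume u: "u \<in> lift n X" and v: "v \<in> lift n X" and t: "0 \<le> t \<and> t \<le> (1::real)"
  have nu: "n \<bullet> u > 0" and nv: "n \<bullet> v > 0" using u v by (auto simp: lift_def)
  then have nz: "u \<noteq> 0" "v \<noteq> 0" by auto
  obtain s where s: "proj_segment (proj_pt u) (proj_pt v) s" "s \<subseteq> X"
    using semi u v unfolding semiconvex_def lift_def by blast
  obtain u' v' where uv': "0 \<notin> closed_segment u' v'" "proj_pt u = proj_pt u'" "proj_pt v = proj_pt v'"
    "s = proj_pt ` closed_segment u' v'"
    using s(1) unfolding proj_segment_def by blast
  then have "u' \<noteq> 0" "v' \<noteq> 0" by auto
  then obtain a b where a: "a \<noteq> 0" "u' = a *\<^sub>R u" and b: "b \<noteq> 0" "v' = b *\<^sub>R v"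
    using proj_pt_eqD nz uv' by metis
  have inX: "proj_pt z \<in> X" "n \<bullet> z \<noteq> 0" if "z \<in> closed_segment u' v'" for z
  proof -
    show "proj_pt z \<in> X" using uv' s(2) that by auto
    moreover have "z \<noteq> 0" using uv' that by auto
    ultimately show "n \<bullet> z \<noteq> 0" using off by (auto simp: off_line_def)
  qed
  have ab: "a * b > 0"
  proof (rule ccontr)
    assume "\<not> a * b > 0"
    then have "a * b < 0" using a b by (simp add: not_less less_le)
    \<comment> \<open>Then \<open>n\<close> changes sign along the segment, so the segment meets the removed line.\<close>
    define p where "p = a * (n \<bullet> u)"
    define q where "q = b * (n \<bullet> v)"
    have "p * q = (a * b) * ((n \<bullet> u) * (n \<bullet> v))" by (simp add: p_def q_def)
    then have pq: "p * q < 0" using \<open>a * b < 0\<close> nu nv by (simp add: mult_neg_pos)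
    then have d: "p - q \<noteq> 0" by (auto simp: mult_less_0_iff)
    define r where "r = p / (p - q)"
    have r: "0 \<le> r" "r \<le> 1" using pq by (auto simp: r_def mult_less_0_iff divide_simps)
    have "(1 - r) * p + r * q = 0" using d by (simp add: r_def field_simps)
    then have "n \<bullet> ((1 - r) *\<^sub>R u' + r *\<^sub>R v') = 0"
      by (simp add: a b p_def q_def inner_add_right)
    moreover have "(1 - r) *\<^sub>R u' + r *\<^sub>R v' \<in> closed_segment u' v'"
      using r by (auto simp: in_segment)
    ultimately show False using inX by blast
  qed
  \<comment> \<open>Rescale the given convex combination of \<open>u\<close> and \<open>v\<close> to one of \<open>a *\<^sub>R u\<close> and \<open>b *\<^sub>R v\<close>.\<close>
  define k where "k = (1 - t) / a + t / b"
  define r where "r = (t / b) / k"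
  have frac: "y / (x + y) \<ge> 0 \<and> y / (x + y) \<le> 1"
    if "x \<ge> 0 \<and> y \<ge> 0 \<or> x \<le> 0 \<and> y \<le> 0" for x y :: real
    using that by (auto simp: zero_le_divide_iff divide_le_eq_1)
  have k: "k \<noteq> 0 \<and> 0 \<le> r \<and> r \<le> 1"
  proof (cases "a > 0")
    case True
    then have "b > 0" using ab by (simp add: zero_less_mult_iff)
    have p: "(1 - t) / a \<ge> 0" "t / b \<ge> 0" using t True \<open>b > 0\<close> by auto
    have "k > 0"
    proof (cases "t = 0")
      case False
      then have "t / b > 0" using t \<open>b > 0\<close> by auto
      then show ?thesis using p by (simp add: k_def)
    qed (use True in \<open>simp add: k_def\<close>)
    moreover have "0 \<le> r \<and> r \<le> 1" unfolding r_def k_def using frac p by blast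
    ultimately show ?thesis by simp
  next
    case False
    then have "a < 0" "b < 0" using ab a by (auto simp: zero_less_mult_iff)
    have p: "(1 - t) / a \<le> 0" "t / b \<le> 0"
      using t \<open>a < 0\<close> \<open>b < 0\<close> by (auto simp: divide_le_0_iff)
    have "k < 0"
    proof (cases "t = 0")
      case False
      then have "t / b < 0" using t \<open>b < 0\<close> by (auto simp: divide_less_0_iff)
      then show ?thesis using p by (simp add: k_def)
    qed (use \<open>a < 0\<close> in \<open>simp add: k_def\<close>)
    moreover have "0 \<le> r \<and> r \<le> 1" unfolding r_def k_def using frac p by blast
    ultimately show ?thesis by simp
  qed
  have r1: "1 - r = ((1 - t) / a) / k"
  proof -
    have "1 - r = (k - t / b) / k" using k by (simp add: r_def diff_divide_distrib)
    then show ?thesis by (simp add: k_def)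
  qed
  have "(1 - t) *\<^sub>R u + t *\<^sub>R v = k *\<^sub>R ((1 - r) *\<^sub>R u' + r *\<^sub>R v')"
  proof -
    have "k * (1 - r) * a = 1 - t" using a k by (simp add: r1)
    moreover have "k * r * b = t" using b k by (simp add: r_def)
    ultimately show ?thesis by (simp add: a b scaleR_add_right mult.assoc[symmetric])
  qed
  moreover have "(1 - r) *\<^sub>R u' + r *\<^sub>R v' \<in> closed_segment u' v'"
    using k by (auto simp: in_segment)
  ultimately have "proj_pt ((1 - t) *\<^sub>R u + t *\<^sub>R v) \<in> X"
    using inX proj_pt_scale k by metis
  moreover have "n \<bullet> ((1 - t) *\<^sub>R u + t *\<^sub>R v) > 0"
  proof -
    have "(1 - t) * (n \<bullet> u) + t * (n \<bullet> v) > 0"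
    proof (cases "t = 0")
      case False
      then have "t * (n \<bullet> v) > 0" "(1 - t) * (n \<bullet> u) \<ge> 0" using t nu nv by auto
      then show ?thesis by linarith
    qed (use nu in simp)
    then show ?thesis by (simp add: inner_add_right)
  qed
  ultimately show "(1 - t) *\<^sub>R u + t *\<^sub>R v \<in> lift n X" by (simp add: lift_def)
qed

lemma off_line_image:
  assumes "\<And>v. v \<in> C \<Longrightarrow> n \<bullet> v > 0" "n \<noteq> 0"
  shows "off_line n (proj_pt ` C)"
  unfolding off_line_def
proof (intro conjI allI impI)
  fix v assume v: "v \<noteq> 0 \<and> proj_pt v \<in> proj_pt ` C"
  then obtain u where u: "u \<in> C" "proj_pt v = proj_pt u" by blast
  moreover have "u \<noteq> 0" using assms(1)[OF u(1)] by auto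
  ultimately obtain c where "c \<noteq> 0" "v = c *\<^sub>R u" using proj_pt_eqD v by metis
  then show "n \<bullet> v \<noteq> 0" using assms(1)[OF u(1)] by simp
qed (rule assms)

lemma proj_convex_image:
  assumes C: "convex C" and pos: "\<And>v. v \<in> C \<Longrightarrow> n \<bullet> v > 0" and "n \<noteq> 0"
  shows "proj_convex (proj_pt ` C)"
  unfolding proj_convex_def
proof
  have nz: "0 \<notin> C" using pos by force
  show "semiconvex (proj_pt ` C)" unfolding semiconvex_def
  proof (intro ballI)
    fix p q assume "p \<in> proj_pt ` C" "q \<in> proj_pt ` C"
    then obtain u v where uv: "u \<in> C" "v \<in> C" "p = proj_pt u" "q = proj_pt v" by blast
    have sub: "closed_segment u v \<subseteq> C" using C uv by (simp add: closed_segment_subset)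
    have "proj_segment p q (proj_pt ` closed_segment u v)"
      unfolding proj_segment_def
      by (rule exI[of _ u], rule exI[of _ v]) (use sub nz uv in auto)
    then show "\<exists>s. proj_segment p q s \<and> s \<subseteq> proj_pt ` C" using sub by blast
  qed
  have "off_line n (proj_pt ` C)" using pos assms(3) by (rule off_line_image)
  then show "\<exists>\<rho>. euclidean_plane \<rho> \<and> proj_pt ` C \<subseteq> \<rho>" by (rule off_line_in_euclidean_plane)
qed

lemma off_line_mono: "off_line n X \<Longrightarrow> Y \<subseteq> X \<Longrightarrow> off_line n Y"
  by (auto simp: off_line_def)

text \<open>Minimality: a convex set between the points and the candidate has a convex lift, which
  therefore contains the ordinary convex hull.\<close>
lemma proj_convex_hull_image:
  assumes pos: "\<And>v. v \<in> W \<Longrightarrow> n \<bullet> v > 0" and "n \<noteq> 0"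
  shows "proj_convex_hull (proj_pt ` W) (proj_pt ` (convex hull W))"
proof -
  have "convex hull W \<subseteq> {v. n \<bullet> v > 0}"
    by (rule hull_minimal) (use pos convex_halfspace_gt in auto)
  then have pos': "n \<bullet> v > 0" if "v \<in> convex hull W" for v using that by auto
  have "Z = proj_pt ` (convex hull W)"
    if Z: "proj_convex Z" "proj_pt ` W \<subseteq> Z" "Z \<subseteq> proj_pt ` (convex hull W)" for Z
  proof -
    have "off_line n Z" using off_line_mono[OF off_line_image[OF pos' assms(2)] Z(3)] .
    then have "convex (lift n Z)" using Z(1) convex_lift by (auto simp: proj_convex_def)
    then have "convex hull W \<subseteq> lift n Z"
      using Z(2) pos by (intro hull_minimal) (auto simp: lift_def)
    then show ?thesis using Z(3) by (auto simp: lift_def)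
  qed
  then show ?thesis
    using proj_convex_image[OF convex_convex_hull pos' assms(2)] hull_subset[of W convex]
    unfolding proj_convex_hull_def by blast
qed

section \<open>Finitely many projective holes\<close>

text \<open>If two hulls of \<open>G\<close> choose the same representatives of the points of \<open>G\<close>, then their lifts intersect in a
  convex set that still contains these representatives.  Its image is a convex set containing \<open>G\<close>
  inside both hulls, so by minimality it equals both.\<close>
lemma proj_convex_hull_unique:
  assumes X: "proj_convex_hull G X" "off_line n X" and Y: "proj_convex_hull G Y" "off_line n' Y"
    and sign: "\<And>v. v \<noteq> 0 \<Longrightarrow> proj_pt v \<in> G \<Longrightarrow> (n \<bullet> v > 0 \<longleftrightarrow> n' \<bullet> v > 0)"
  shows "X = Y"
proof -
  let ?C = "lift n X \<inter> lift n' Y"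
  let ?Z = "proj_pt ` ?C"
  have "convex ?C"
    using X Y by (intro convex_Int convex_lift) (auto simp: proj_convex_hull_def proj_convex_def)
  moreover have "n \<noteq> 0" using X(2) by (simp add: off_line_def)
  ultimately have Z: "proj_convex ?Z"
    by (intro proj_convex_image[of _ n]) (auto simp: lift_def)
  have "G \<subseteq> ?Z"
  proof
    fix g assume g: "g \<in> G"
    obtain v where v: "v \<noteq> 0" "proj_pt v = g" by (rule proj_pt_surj)
    have gXY: "g \<in> X" "g \<in> Y" using g X Y by (auto simp: proj_convex_hull_def)
    then have nz: "n \<bullet> v \<noteq> 0" using X(2) v by (auto simp: off_line_def)
    define w where "w = (if n \<bullet> v > 0 then v else - v)"
    have w: "w \<noteq> 0" "proj_pt w = g" "n \<bullet> w > 0"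
      using v nz proj_pt_scale[of "-1" v] by (auto simp: w_def)
    then have "n' \<bullet> w > 0" using sign g by blast
    then have "w \<in> ?C" using w gXY by (simp add: lift_def)
    then show "g \<in> ?Z" using w by blast
  qed
  moreover have "?Z \<subseteq> X" "?Z \<subseteq> Y" by (auto simp: lift_def)
  ultimately show "X = Y" using X(1) Y(1) Z unfolding proj_convex_hull_def by metis
qed

text \<open>By the previous lemma a hull is determined by the signs that its removed line gives to fixed
  representatives of the points of \<open>G\<close>.\<close>
lemma finite_proj_convex_hulls:
  assumes "finite G"
  shows "finite {X. proj_convex_hull G X}"
proof -
  define rep where "rep g = (SOME v. v \<noteq> 0 \<and> proj_pt v = g)" for g
  have rep: "rep g \<noteq> 0 \<and> proj_pt (rep g) = g" for g
    unfolding rep_def by (rule someI_ex) (metis proj_pt_surj)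
  define nrm where "nrm X = (SOME n. off_line n X)" for X
  have nrm: "off_line (nrm X) X" if "proj_convex_hull G X" for X
  proof -
    have "\<exists>n. off_line n X"
      using that in_euclidean_plane_off_line unfolding proj_convex_hull_def proj_convex_def by blast
    then show ?thesis unfolding nrm_def by (rule someI_ex)
  qed
  define f where "f X = {g \<in> G. nrm X \<bullet> rep g > 0}" for X
  have "inj_on f {X. proj_convex_hull G X}"
  proof (intro inj_onI, clarify)
    fix X Y assume X: "proj_convex_hull G X" and Y: "proj_convex_hull G Y" and eq: "f X = f Y"
    show "X = Y"
    proof (rule proj_convex_hull_unique[OF X nrm[OF X] Y nrm[OF Y]])
      fix v assume v: "v \<noteq> 0" "proj_pt v \<in> G"
      then obtain c where c: "c \<noteq> 0" "v = c *\<^sub>R rep (proj_pt v)"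
        using proj_pt_eqD[of v "rep (proj_pt v)"] rep[of "proj_pt v"] by auto
      let ?g = "proj_pt v"
      have in': "?g \<in> X" "?g \<in> Y" using v X Y by (auto simp: proj_convex_hull_def)
      have nz: "nrm X \<bullet> rep ?g \<noteq> 0" "nrm Y \<bullet> rep ?g \<noteq> 0"
        using nrm[OF X] nrm[OF Y] in' rep[of ?g] by (auto simp: off_line_def)
      have "nrm X \<bullet> rep ?g > 0 \<longleftrightarrow> nrm Y \<bullet> rep ?g > 0"
        using eq v(2) by (auto simp: f_def)
      moreover have "nrm Z \<bullet> v = c * (nrm Z \<bullet> rep ?g)" for Z
        by (subst c(2)) simp
      ultimately show "nrm X \<bullet> v > 0 \<longleftrightarrow> nrm Y \<bullet> v > 0"
        using nz c(1) by (auto simp: zero_less_mult_iff)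
    qed
  qed
  moreover have "f ` {X. proj_convex_hull G X} \<subseteq> Pow G" by (auto simp: f_def)
  ultimately show ?thesis using assms by (meson finite_Pow_iff inj_on_finite)
qed

text \<open>Needed because the cardinality of an infinite set is \<open>0\<close>: a lower bound on the number of
  projective holes has to come with their finiteness.\<close>
lemma finite_proj_holes:
  assumes "finite P"
  shows "finite (proj_holes P)"
proof (rule finite_subset)
  show "proj_holes P \<subseteq> (\<Union>G\<in>Pow P. {X. proj_convex_hull G X})"
    by (auto simp: proj_holes_def proj_k_hole_def proj_k_gon_def)
  show "finite (\<Union>G\<in>Pow P. {X. proj_convex_hull G X})"
    using assms finite_subset by (intro finite_UN_I) (auto intro: finite_proj_convex_hulls)
qed

section \<open>Projective holes on a conic\<close>

text \<open>The conic \<open>x * y = z\<^sup>2\<close> in the chart \<open>x = 1\<close>, where it is a parabola.  In the standard chart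
  \<open>z = 1\<close> it is the hyperbola \<open>x * y = 1\<close>, whose two branches thus form one convex curve.\<close>
definition parabola :: "real \<Rightarrow> real^3" where
  "parabola s = vector [1, s\<^sup>2, s]"

lemma parabola_nth [simp]: "parabola s $ 1 = 1" "parabola s $ 2 = s\<^sup>2" "parabola s $ 3 = s"
  by (simp_all add: parabola_def)

lemma parabola_nonzero [simp]: "parabola s \<noteq> 0"
  by (metis parabola_nth(1) zero_index zero_neq_one)

definition parabola_hull :: "real set \<Rightarrow> rp2 set" where
  "parabola_hull \<sigma> = proj_pt ` (convex hull (parabola ` \<sigma>))"

lemma parabola_hull_nth1:
  assumes "v \<in> convex hull (parabola ` \<sigma>)"
  shows "v $ 1 = 1"
proof -
  have "convex {v :: real^3. v $ 1 = 1}" by (auto simp: convex_def)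
  then have "convex hull (parabola ` \<sigma>) \<subseteq> {v. v $ 1 = 1}" by (intro hull_minimal) auto
  then show ?thesis using assms by auto
qed

text \<open>All points of the parabola except \<open>parabola s\<close> lie strictly on one side of its tangent at \<open>parabola s\<close>.
  So the vertices of a polygon inscribed in the parabola can be recovered from the polygon.\<close>
lemma parabola_in_hull_iff: "proj_pt (parabola s) \<in> parabola_hull \<sigma> \<longleftrightarrow> s \<in> \<sigma>"
proof
  assume "s \<in> \<sigma>"
  then show "proj_pt (parabola s) \<in> parabola_hull \<sigma>"
    unfolding parabola_hull_def by (intro imageI hull_inc) auto
next
  assume "proj_pt (parabola s) \<in> parabola_hull \<sigma>"
  then obtain v where v: "v \<in> convex hull (parabola ` \<sigma>)" "proj_pt (parabola s) = proj_pt v"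
    by (auto simp: parabola_hull_def)
  have v1: "v $ 1 = 1" by (rule parabola_hull_nth1[OF v(1)])
  then have "v \<noteq> 0" by auto
  then obtain c where c: "parabola s = c *\<^sub>R v" using proj_pt_eqD[OF v(2)] by auto
  then have "c = 1" using v1 by (metis parabola_nth(1) mult.right_neutral real_scaleR_def vector_scaleR_component)
  then have in_hull: "parabola s \<in> convex hull (parabola ` \<sigma>)" using c v(1) by simp
  show "s \<in> \<sigma>"
  proof (rule ccontr)
    assume "s \<notin> \<sigma>"
    define T where "T = {v :: real^3. v$2 - 2 * s * v$3 + s\<^sup>2 * v$1 > 0}"
    have "T = {v. vector [s\<^sup>2, 1, - 2 * s] \<bullet> v > 0}"
      by (auto simp: T_def inner_vec_def sum_3 algebra_simps)
    then have "convex T" by (simp add: convex_halfspace_gt)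
    moreover have "parabola ` \<sigma> \<subseteq> T"
    proof
      fix w assume "w \<in> parabola ` \<sigma>"
      then obtain t where t: "t \<in> \<sigma>" "w = parabola t" by blast
      have "(t - s)\<^sup>2 > 0" using t \<open>s \<notin> \<sigma>\<close> by auto
      then show "w \<in> T" by (simp add: T_def t power2_diff algebra_simps)
    qed
    ultimately have "convex hull (parabola ` \<sigma>) \<subseteq> T" by (rule hull_minimal[rotated])
    then show False using in_hull by (auto simp: T_def power2_eq_square)
  qed
qed

lemma proj_pt_parabola_inj: "proj_pt (parabola s) = proj_pt (parabola t) \<Longrightarrow> s = t"
  using parabola_in_hull_iff[of s "{t}"] parabola_in_hull_iff[of t "{t}"] by simp

lemma parabola_hull_inj: "parabola_hull \<sigma> = parabola_hull \<tau> \<Longrightarrow> \<sigma> = \<tau>"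
  using parabola_in_hull_iff by blast

lemma proj_convex_hull_parabola: "proj_convex_hull (proj_pt ` parabola ` \<sigma>) (parabola_hull \<sigma>)"
  unfolding parabola_hull_def
proof (rule proj_convex_hull_image)
  show "axis 1 1 \<bullet> v > 0" if "v \<in> parabola ` \<sigma>" for v using that by (auto simp: inner_axis')
  show "axis 1 1 \<noteq> (0 :: real^3)" by (simp add: axis_eq_0_iff)
qed

text \<open>The convex side of the parabola is the intersection of the half-planes bounded by its
  tangents; the tangent at parameter \<open>v $ 3\<close> gives the inequality.\<close>
lemma parabola_hull_subset:
  assumes "v \<in> convex hull (parabola ` \<sigma>)"
  shows "v$1 * v$2 \<ge> (v$3)\<^sup>2"
proof -
  have "convex hull (parabola ` \<sigma>) \<subseteq> (\<Inter>s. {v. v$2 - 2 * s * v$3 + s\<^sup>2 * v$1 \<ge> 0})"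
  proof (rule hull_minimal)
    have "convex {v :: real^3. v$2 - 2 * s * v$3 + s\<^sup>2 * v$1 \<ge> 0}" for s
    proof -
      have "{v :: real^3. v$2 - 2 * s * v$3 + s\<^sup>2 * v$1 \<ge> 0} = {v. vector [s\<^sup>2, 1, - 2 * s] \<bullet> v \<ge> 0}"
        by (auto simp: inner_vec_def sum_3 algebra_simps)
      then show ?thesis by (simp add: convex_halfspace_ge)
    qed
    then show "convex (\<Inter>s. {v :: real^3. v$2 - 2 * s * v$3 + s\<^sup>2 * v$1 \<ge> 0})"
      by (intro convex_INT) auto
    show "parabola ` \<sigma> \<subseteq> (\<Inter>s. {v. v$2 - 2 * s * v$3 + s\<^sup>2 * v$1 \<ge> 0})"
    proof clarsimp
      fix t s :: real
      have "(t - s)\<^sup>2 \<ge> 0" by simp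
      then show "0 \<le> t\<^sup>2 - 2 * s * t + s\<^sup>2" by (simp add: power2_diff algebra_simps)
    qed
  qed
  then have "v$2 - 2 * v$3 * v$3 + (v$3)\<^sup>2 * v$1 \<ge> 0" using assms by blast
  then show ?thesis using parabola_hull_nth1[OF assms] by (simp add: power2_eq_square)
qed

text \<open>The polygon lies in \<open>x * y \<ge> z\<^sup>2\<close>, a condition invariant under rescaling.  A point \<open>p\<close> with
  \<open>p $ 1 * p $ 2 \<le> 1\<close> has arbitrarily close points that violate it.\<close>
lemma not_in_interior_parabola_hull:
  assumes p: "p$1 * p$2 \<le> 1"
  shows "embed_plane p \<notin> interior (parabola_hull \<sigma>)"
proof
  assume "embed_plane p \<in> interior (parabola_hull \<sigma>)"
  then obtain U where U: "open U" "embed_plane p \<in> U" "U \<subseteq> parabola_hull \<sigma>"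
    by (auto simp: interior_def)
  define V where "V = {v. v \<noteq> 0 \<and> proj_pt v \<in> U}"
  have "open V" using U(1) by (simp add: V_def open_rp2_def)
  \<comment> \<open>Moving by \<open>- e * p $ 1\<close> lowers the product of the coordinates whatever the sign of \<open>p $ 1\<close>.\<close>
  define v :: "real \<Rightarrow> real^3" where "v e = vector [p$1, p$2 - e * p$1, 1]" for e
  have nth: "v e $ 1 = p$1" "v e $ 2 = p$2 - e * p$1" "v e $ 3 = 1" for e
    by (simp_all add: v_def)
  have nz: "v e \<noteq> 0" for e using nth(3)[of e] by (metis zero_index zero_neq_one)
  have "v 0 \<in> V" using U(2) nz[of 0] by (simp add: V_def embed_plane_def v_def)
  have "(v \<longlongrightarrow> v 0) (at_right 0)"
  proof -
    have eq: "v = (\<lambda>e. v 0 + e *\<^sub>R vector [0, - p$1, 0])"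
      by (auto simp: fun_eq_iff vec_eq_iff forall_3 nth)
    show ?thesis by (subst eq) (auto intro!: tendsto_eq_intros)
  qed
  then have "\<forall>\<^sub>F e in at_right 0. v e \<in> V"
    using \<open>open V\<close> \<open>v 0 \<in> V\<close> by (rule topological_tendstoD)
  then have "\<forall>\<^sub>F e in at_right 0. v e \<in> V \<and> e > 0"
    using eventually_at_right_less by (rule eventually_conj)
  then obtain e where e: "v e \<in> V" "e > 0"
    using eventually_happens'[OF trivial_limit_at_right_real] by blast
  then have "proj_pt (v e) \<in> parabola_hull \<sigma>" using U(3) by (auto simp: V_def)
  then obtain w where w: "w \<in> convex hull (parabola ` \<sigma>)" "proj_pt (v e) = proj_pt w"
    by (auto simp: parabola_hull_def)
  then have "w \<noteq> 0" using parabola_hull_nth1 by force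
  then obtain c where c: "v e = c *\<^sub>R w" using proj_pt_eqD[OF w(2)] nz by blast
  have "v e $ 1 * v e $ 2 - (v e $ 3)\<^sup>2 = c\<^sup>2 * (w$1 * w$2 - (w$3)\<^sup>2)"
    by (simp add: c power2_eq_square algebra_simps)
  also have "\<dots> \<ge> 0" using parabola_hull_subset[OF w(1)] by simp
  finally have ge: "p$1 * p$2 - e * (p$1)\<^sup>2 \<ge> 1" by (simp add: nth power2_eq_square algebra_simps)
  show False
  proof (cases "p$1 = 0")
    case False
    then have "e * (p$1)\<^sup>2 > 0" using e by simp
    then show False using ge p by linarith
  qed (use ge in simp)
qed

definition hyperbola :: "real \<Rightarrow> real^2" where
  "hyperbola s = vector [1 / s, s]"

lemma hyperbola_nth [simp]: "hyperbola s $ 1 = 1 / s" "hyperbola s $ 2 = s"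
  by (simp_all add: hyperbola_def)

lemma embed_hyperbola:
  assumes "s \<noteq> 0"
  shows "embed_plane (hyperbola s) = proj_pt (parabola s)"
proof -
  have "parabola s = s *\<^sub>R vector [1 / s, s, 1]"
    using assms by (simp add: vec_eq_iff forall_3 power2_eq_square)
  then show ?thesis using assms proj_pt_scale by (simp add: embed_plane_def)
qed

text \<open>Since the points of \<open>G\<close> belong to \<open>S\<close>, the fact that no point of \<open>S\<close> is interior shows both that
  the polygon is empty and that its vertices are on its boundary.\<close>
lemma parabola_hull_proj_hole:
  assumes \<sigma>: "finite \<sigma>" "card \<sigma> \<ge> 3" "0 \<notin> \<sigma>" "hyperbola ` \<sigma> \<subseteq> S"
    and S: "\<And>p. p \<in> S \<Longrightarrow> p$1 * p$2 \<le> 1"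
  shows "parabola_hull \<sigma> \<in> proj_holes (embed_plane ` S)"
proof -
  have im: "embed_plane ` hyperbola ` \<sigma> = proj_pt ` parabola ` \<sigma>"
    using \<sigma>(3) embed_hyperbola unfolding image_image by (intro image_cong) metis+
  have "card (proj_pt ` parabola ` \<sigma>) = card \<sigma>"
    unfolding image_image by (rule card_image) (auto intro!: inj_onI proj_pt_parabola_inj)
  moreover have hull: "proj_convex_hull (proj_pt ` parabola ` \<sigma>) (parabola_hull \<sigma>)"
    by (rule proj_convex_hull_parabola)
  moreover have int: "interior (parabola_hull \<sigma>) \<inter> embed_plane ` S = {}"
    using not_in_interior_parabola_hull S by blast
  moreover have sub: "proj_pt ` parabola ` \<sigma> \<subseteq> embed_plane ` S" using \<sigma>(4) im by blast
  moreover have "proj_pt ` parabola ` \<sigma> \<subseteq> frontier (parabola_hull \<sigma>)"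
  proof -
    have "proj_pt ` parabola ` \<sigma> \<subseteq> parabola_hull \<sigma>" using hull by (simp add: proj_convex_hull_def)
    then have "proj_pt ` parabola ` \<sigma> \<subseteq> closure (parabola_hull \<sigma>)"
      using closure_subset by (rule subset_trans)
    moreover have "proj_pt ` parabola ` \<sigma> \<inter> interior (parabola_hull \<sigma>) = {}"
      using int sub by blast
    ultimately show ?thesis unfolding frontier_def by blast
  qed
  ultimately have "proj_k_hole (card \<sigma>) (embed_plane ` S) (parabola_hull \<sigma>)"
    unfolding proj_k_hole_def proj_k_gon_def using \<sigma> by blast
  then show ?thesis using \<sigma>(2) unfolding proj_holes_def by blast
qed

text \<open>Every subset of \<open>\<Sigma>\<close> with at least three elements yields its own projective hole.  Counting only
  those that contain a fixed triple loses just a constant factor.\<close>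
lemma card_proj_holes_ge:
  assumes \<Sigma>: "finite \<Sigma>" "card \<Sigma> \<ge> 3" "0 \<notin> \<Sigma>" "hyperbola ` \<Sigma> \<subseteq> S"
    and S: "finite S" "\<And>p. p \<in> S \<Longrightarrow> p$1 * p$2 \<le> 1"
  shows "2 ^ (card \<Sigma> - 3) \<le> card (proj_holes (embed_plane ` S))"
proof -
  obtain T where T: "T \<subseteq> \<Sigma>" "card T = 3" using \<Sigma>(2) obtain_subset_with_card_n by metis
  have finT: "finite T" using T \<Sigma>(1) finite_subset by blast
  have "card (Pow (\<Sigma> - T)) \<le> card (proj_holes (embed_plane ` S))"
  proof (rule card_inj_on_le)
    show "inj_on (\<lambda>\<tau>. parabola_hull (T \<union> \<tau>)) (Pow (\<Sigma> - T))"
      by (rule inj_onI) (drule parabola_hull_inj, blast)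
    show "(\<lambda>\<tau>. parabola_hull (T \<union> \<tau>)) ` Pow (\<Sigma> - T) \<subseteq> proj_holes (embed_plane ` S)"
    proof (rule image_subsetI)
      fix \<tau> assume \<tau>: "\<tau> \<in> Pow (\<Sigma> - T)"
      show "parabola_hull (T \<union> \<tau>) \<in> proj_holes (embed_plane ` S)"
      proof (rule parabola_hull_proj_hole)
        show fin: "finite (T \<union> \<tau>)" using \<tau> \<Sigma>(1) finT finite_subset[of \<tau> \<Sigma>] by blast
        show "card (T \<union> \<tau>) \<ge> 3" using T(2) card_mono[OF fin, of T] by simp
      qed (use \<tau> T \<Sigma> S in auto)
    qed
    show "finite (proj_holes (embed_plane ` S))" using S by (simp add: finite_proj_holes)
  qed
  moreover have "card (\<Sigma> - T) = card \<Sigma> - 3" using T finT by (simp add: card_Diff_subset)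
  ultimately show ?thesis using \<Sigma>(1) by (simp add: card_Pow)
qed

section \<open>Holes of a Horton set together with two arcs\<close>

lemma three_ordered_elements:
  fixes T :: "'a :: linorder set"
  assumes "finite T" "card T \<ge> 3"
  obtains i j k where "i \<in> T" "j \<in> T" "k \<in> T" "i < j" "j < k"
proof -
  have ne: "T \<noteq> {}" using assms by auto
  have "card (T - {Min T, Max T}) \<ge> card T - card {Min T, Max T}"
    by (rule diff_card_le_card_Diff) simp
  moreover have "card {Min T, Max T} \<le> 2" by (simp add: card_insert_if)
  ultimately have "card (T - {Min T, Max T}) > 0" using assms by linarith
  then obtain j where j: "j \<in> T" "j \<noteq> Min T" "j \<noteq> Max T" by (auto simp: card_gt_0_iff)
  show thesis
    by (rule that[of "Min T" j "Max T"]) (use j ne assms in \<open>auto simp: order.strict_iff_order\<close>)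
qed

text \<open>If the arc bulges towards \<open>p\<close>, then for three vertices on the arc the middle one lies inside
  the triangle formed by the other two and \<open>p\<close>.\<close>
lemma arc_vertices_le_2:
  fixes f :: "real \<Rightarrow> real^2"
  assumes V: "V \<in> hole_sets S" and "f ` \<tau> \<subseteq> S" "finite \<tau>" "p \<in> V"
    and arc: "\<And>i j k. i \<in> \<tau> \<Longrightarrow> j \<in> \<tau> \<Longrightarrow> k \<in> \<tau> \<Longrightarrow> i < j \<Longrightarrow> j < k \<Longrightarrow> orient (f i) (f k) (f j) > 0"
    and front: "\<And>i j. i \<in> \<tau> \<Longrightarrow> j \<in> \<tau> \<Longrightarrow> i < j \<Longrightarrow> orient (f i) (f j) p > 0"
  shows "card (V \<inter> f ` \<tau>) \<le> 2"
proof (rule ccontr)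
  assume "\<not> card (V \<inter> f ` \<tau>) \<le> 2"
  define T where "T = {t \<in> \<tau>. f t \<in> V}"
  have "V \<inter> f ` \<tau> = f ` T" by (auto simp: T_def)
  moreover have finT: "finite T" using assms(3) by (simp add: T_def)
  ultimately have "card T \<ge> 3"
    using card_image_le[OF finT, of f] \<open>\<not> card (V \<inter> f ` \<tau>) \<le> 2\<close> by simp
  then obtain i j k where ijk: "i \<in> T" "j \<in> T" "k \<in> T" "i < j" "j < k"
    using three_ordered_elements finT by blast
  show False
  proof (rule hole_sets_no_interior_triangle[OF V, of "f i" "f k" p "f j"])
    show "orient (f k) p (f j) > 0" "orient p (f i) (f j) > 0"
      using front[of j k] front[of i j] ijk
      unfolding T_def orient_rotate[of "f k" p "f j"] orient_rotate[of p "f i" "f j"]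
        orient_rotate[of "f j" p "f i"] by simp_all
  qed (use ijk assms in \<open>auto simp: T_def\<close>)
qed

lemma small_subsets:
  assumes "finite A"
  shows "finite {X. X \<subseteq> A \<and> card X \<le> 2}" "card {X. X \<subseteq> A \<and> card X \<le> 2} \<le> (card A)\<^sup>2 + 1"
proof -
  have sub: "{X. X \<subseteq> A \<and> card X \<le> 2} \<subseteq> insert {} ((\<lambda>(a, b). {a, b}) ` (A \<times> A))"
  proof
    fix X assume "X \<in> {X. X \<subseteq> A \<and> card X \<le> 2}"
    then have X: "X \<subseteq> A" "card X \<le> 2" "finite X" using assms finite_subset by auto
    then consider "card X = 0" | "card X = 1" | "card X = 2" by linarith
    then show "X \<in> insert {} ((\<lambda>(a, b). {a, b}) ` (A \<times> A))"
    proof cases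
      case 2
      then obtain a where "X = {a}" by (auto simp: card_1_singleton_iff)
      then show ?thesis using X by (auto intro!: image_eqI[of _ _ "(a, a)"])
    next
      case 3
      then obtain a b where "X = {a, b}" by (auto simp: card_2_iff)
      then show ?thesis using X by (auto intro!: image_eqI[of _ _ "(a, b)"])
    qed (use X in auto)
  qed
  have fin: "finite (insert {} ((\<lambda>(a, b). {a, b}) ` (A \<times> A)))" using assms by simp
  show "finite {X. X \<subseteq> A \<and> card X \<le> 2}" using sub fin by (rule finite_subset)
  have "card {X. X \<subseteq> A \<and> card X \<le> 2} \<le> card (insert {} ((\<lambda>(a, b). {a, b}) ` (A \<times> A)))"
    using fin sub by (rule card_mono)
  also have "\<dots> \<le> Suc (card ((\<lambda>(a, b). {a, b}) ` (A \<times> A)))" by (rule card_insert_le_m1[THEN order_trans]) auto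
  also have "card ((\<lambda>(a, b). {a, b}) ` (A \<times> A)) \<le> card (A \<times> A)"
    using assms by (intro card_image_le) auto
  finally show "card {X. X \<subseteq> A \<and> card X \<le> 2} \<le> (card A)\<^sup>2 + 1"
    by (simp add: card_cartesian_product power2_eq_square)
qed

text \<open>A hole is contained in one of the three parts, or it is the union of a set that is empty or
  open above in \<open>P\<close> and of at most two points from each of \<open>A\<close> and \<open>B\<close>.  The number of holes of the
  second kind is only linear in \<open>card P\<close>, which is what makes the bound useful.\<close>
lemma card_hole_sets_horton_arcs:
  assumes P: "horton P" "far_below P (A \<union> B)" and fin: "finite A" "finite B"
    and A2: "\<And>V p. V \<in> hole_sets (P \<union> (A \<union> B)) \<Longrightarrow> p \<in> V \<Longrightarrow> p \<in> P \<union> B \<Longrightarrow> card (V \<inter> A) \<le> 2"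
    and B2: "\<And>V p. V \<in> hole_sets (P \<union> (A \<union> B)) \<Longrightarrow> p \<in> V \<Longrightarrow> p \<in> P \<union> A \<Longrightarrow> card (V \<inter> B) \<le> 2"
  shows "card (hole_sets (P \<union> (A \<union> B))) \<le>
    8 * (card P)\<^sup>2 + 2 ^ card A + 2 ^ card B + (4 * card P + 1) * (((card A)\<^sup>2 + 1) * ((card B)\<^sup>2 + 1))"
proof -
  let ?S = "P \<union> (A \<union> B)"
  define F where "F = insert {} {G. open_above P G}"
  define A' where "A' = {X. X \<subseteq> A \<and> card X \<le> 2}"
  define B' where "B' = {X. X \<subseteq> B \<and> card X \<le> 2}"
  let ?u = "\<lambda>(X, Y, Z). X \<union> Y \<union> Z"
  have finP: "finite P" using P horton_finite by blast
  have finF: "finite F" "finite A'" "finite B'"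
    using finP fin finite_open_above small_subsets(1) by (auto simp: F_def A'_def B'_def)
  have cF: "card F \<le> 4 * card P + 1"
    unfolding F_def using card_open_above[OF P(1)] finite_open_above[OF finP]
    by (simp add: card_insert_if)
  have "hole_sets ?S \<subseteq> hole_sets P \<union> Pow A \<union> Pow B \<union> ?u ` (F \<times> A' \<times> B')"
  proof
    fix V assume V: "V \<in> hole_sets ?S"
    then have sub: "V \<subseteq> ?S" by (simp add: hole_sets_def)
    consider "V \<subseteq> P" | "V \<subseteq> A" | "V \<subseteq> B" | "\<not> V \<subseteq> P" "\<not> V \<subseteq> A" "\<not> V \<subseteq> B" by blast
    then show "V \<in> hole_sets P \<union> Pow A \<union> Pow B \<union> ?u ` (F \<times> A' \<times> B')"
    proof cases
      case 1
      then have "V \<in> hole_sets P" using V by (auto simp: hole_sets_def)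
      then show ?thesis by blast
    next
      case 4
      obtain t where t: "t \<in> V" "t \<in> A \<union> B" using 4(1) sub by blast
      have "V \<inter> P \<in> F"
      proof (cases "V \<inter> P = {}")
        case False
        then show ?thesis
          using hole_set_open_above[OF V _ False t P(2)] by (simp add: F_def)
      qed (simp add: F_def)
      moreover have "V \<inter> A \<in> A'"
      proof -
        obtain p where "p \<in> V" "p \<in> P \<union> B" using 4(2) sub by blast
        then show ?thesis using A2[OF V] by (auto simp: A'_def)
      qed
      moreover have "V \<inter> B \<in> B'"
      proof -
        obtain p where "p \<in> V" "p \<in> P \<union> A" using 4(3) sub by blast
        then show ?thesis using B2[OF V] by (auto simp: B'_def)
      qed
      moreover have "V = ?u (V \<inter> P, V \<inter> A, V \<inter> B)" using sub by auto
      ultimately show ?thesis by (intro UnI2 image_eqI[of _ _ "(V \<inter> P, V \<inter> A, V \<inter> B)"]) auto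
    qed auto
  qed
  then have "card (hole_sets ?S) \<le> card (hole_sets P \<union> Pow A \<union> Pow B \<union> ?u ` (F \<times> A' \<times> B'))"
    using finP finF fin hole_sets_finite by (intro card_mono) auto
  also have "\<dots> \<le> card (hole_sets P) + card (Pow A) + card (Pow B) + card (?u ` (F \<times> A' \<times> B'))"
    by (meson add_le_mono card_Un_le le_trans order_refl)
  also have "card (?u ` (F \<times> A' \<times> B')) \<le> card F * (card A' * card B')"
    using card_image_le[of "F \<times> A' \<times> B'" ?u] finF by (simp add: card_cartesian_product)
  also have "\<dots> \<le> (4 * card P + 1) * (((card A)\<^sup>2 + 1) * ((card B)\<^sup>2 + 1))"
    using cF small_subsets(2) fin by (intro mult_le_mono) (auto simp: A'_def B'_def)
  finally show ?thesis
    using card_hole_sets_horton[OF P(1)] fin by (simp add: card_Pow)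
qed

section \<open>Points on the hyperbola\<close>

lemma hyperbola_uminus: "hyperbola (- s) = - hyperbola s"
  by (simp add: vec_eq_iff forall_2)

lemma inj_hyperbola: "inj hyperbola"
  by (rule injI) (metis hyperbola_nth(2))

lemma orient_hyperbola:
  assumes "s \<noteq> 0" "t \<noteq> 0" "r \<noteq> 0"
  shows "orient (hyperbola s) (hyperbola t) (hyperbola r) = (s - t) * (r - s) * (r - t) / (s * t * r)"
  using assms by (simp add: orient_def field_simps)

lemma orient_hyperbola_origin:
  assumes "s \<noteq> 0" "t \<noteq> 0"
  shows "orient (hyperbola s) (hyperbola t) 0 = (t\<^sup>2 - s\<^sup>2) / (s * t)"
  using assms by (simp add: orient_def field_simps power2_eq_square)

lemma no_three_collinear_hyperbola:
  assumes "0 \<notin> \<Sigma>"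
  shows "no_three_collinear (hyperbola ` \<Sigma>)"
proof -
  have "orient (hyperbola s) (hyperbola t) (hyperbola r) \<noteq> 0"
    if "s \<in> \<Sigma>" "t \<in> \<Sigma>" "r \<in> \<Sigma>" "s \<noteq> t" "s \<noteq> r" "t \<noteq> r" for s t r
  proof -
    have "s \<noteq> 0" "t \<noteq> 0" "r \<noteq> 0" using that assms by auto
    then show ?thesis using that by (simp add: orient_hyperbola)
  qed
  then show ?thesis unfolding no_three_collinear_def by auto
qed

text \<open>Squeeze a Horton set by \<open>(x, y) \<mapsto> (e * x, e * x + e\<^sup>2 * y)\<close>.  As \<open>e\<close> tends to \<open>0\<close>, it shrinks to the
  origin, and all lines through two of its points approach the line \<open>y = x\<close>.  The required
  conditions are strict inequalities that hold in the limit: the given points of the hyperbola are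
  above \<open>y = x\<close> because \<open>1 / s < s\<close>, and the origin is on no line through two of them because
  their parameters have distinct squares.\<close>
lemma horton_near_origin:
  assumes fin: "finite \<Sigma>" and \<Sigma>: "\<And>s. s \<in> \<Sigma> \<Longrightarrow> s \<noteq> 0 \<and> 1 / s < s"
    and sq: "\<And>s t. s \<in> \<Sigma> \<Longrightarrow> t \<in> \<Sigma> \<Longrightarrow> s \<noteq> t \<Longrightarrow> s\<^sup>2 \<noteq> t\<^sup>2"
  obtains H where "horton H" "card H = n" "far_below H (hyperbola ` \<Sigma>)" "\<And>h. h \<in> H \<Longrightarrow> h$1 * h$2 < 1"
    "\<And>h s t. h \<in> H \<Longrightarrow> s \<in> \<Sigma> \<Longrightarrow> t \<in> \<Sigma> \<Longrightarrow> s \<noteq> t \<Longrightarrow>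
       orient (hyperbola s) (hyperbola t) h * orient (hyperbola s) (hyperbola t) 0 > 0"
proof -
  obtain P where P: "horton P" "(\<lambda>p. p$1) ` P = real ` {..<n}" using horton_exists by blast
  have finP: "finite P" using P horton_finite by blast
  have cardP: "card P = n"
    using card_image[OF horton_inj[OF P(1)]] P(2) by (simp add: card_image)
  define T where "T e = shear e 0 e (e\<^sup>2) 0" for e
  have T: "T e p $ 1 = e * p$1" "T e p $ 2 = e * p$1 + e\<^sup>2 * p$2" for e p
    by (simp_all add: T_def)
  have ev1: "\<forall>\<^sub>F e in at_right 0. T e p $ 1 * T e p $ 2 < 1" for p
  proof (rule order_tendstoD)
    show "((\<lambda>e. T e p $ 1 * T e p $ 2) \<longlongrightarrow> 0) (at_right 0)"
      unfolding T by (auto intro!: tendsto_eq_intros)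
  qed simp
  have ev2: "\<forall>\<^sub>F e in at_right 0. orient (hyperbola s) (hyperbola t) (T e p) * orient (hyperbola s) (hyperbola t) 0 > 0"
    if st: "s \<in> \<Sigma>" "t \<in> \<Sigma>" "s \<noteq> t" for s t p
  proof (rule order_tendstoD)
    let ?c = "orient (hyperbola s) (hyperbola t) 0"
    show "((\<lambda>e. orient (hyperbola s) (hyperbola t) (T e p) * ?c) \<longlongrightarrow> ?c * ?c) (at_right 0)"
      unfolding orient_def[of "hyperbola s" "hyperbola t" "T e p" for e] T
      by (auto intro!: tendsto_eq_intros simp: orient_def)
    have "s\<^sup>2 \<noteq> t\<^sup>2" using sq st by blast
    then have "?c \<noteq> 0" using \<Sigma> st by (simp add: orient_hyperbola_origin)
    then show "0 < ?c * ?c" by (auto simp: zero_less_mult_iff)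
  qed
  have ev3: "\<forall>\<^sub>F e in at_right 0. orient (T e p) (T e q) (hyperbola s) > 0"
    if s: "s \<in> \<Sigma>" and pq: "p$1 < q$1" for s p q
  proof -
    define g where "g e = (q$1 - p$1) * (s - 1 / s - e\<^sup>2 * p$2) - e * (q$2 - p$2) * (1 / s - e * p$1)"
      for e
    \<comment> \<open>The orientation itself tends to \<open>0\<close>; only after division by \<open>e\<close> is the limit positive.\<close>
    have eq: "orient (T e p) (T e q) (hyperbola s) = e * g e" for e
      by (simp add: orient_def T g_def power2_eq_square algebra_simps)
    have "(g \<longlongrightarrow> (q$1 - p$1) * (s - 1 / s)) (at_right 0)"
      unfolding g_def by (auto intro!: tendsto_eq_intros)
    moreover have "(q$1 - p$1) * (s - 1 / s) > 0" using \<Sigma>[OF s] pq by simp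
    ultimately have "\<forall>\<^sub>F e in at_right 0. g e > 0" by (rule order_tendstoD)
    then show ?thesis using eventually_at_right_less[of 0]
      by eventually_elim (simp add: eq)
  qed
  have "\<forall>\<^sub>F e in at_right 0. (\<forall>p\<in>P. T e p $ 1 * T e p $ 2 < 1) \<and>
    (\<forall>p\<in>P. \<forall>s\<in>\<Sigma>. \<forall>t\<in>\<Sigma>. s \<noteq> t \<longrightarrow> orient (hyperbola s) (hyperbola t) (T e p) * orient (hyperbola s) (hyperbola t) 0 > 0) \<and>
    (\<forall>p\<in>P. \<forall>q\<in>P. \<forall>s\<in>\<Sigma>. p$1 < q$1 \<longrightarrow> orient (T e p) (T e q) (hyperbola s) > 0) \<and> e > 0"
    using finP fin ev1 ev2 ev3 eventually_at_right_less[of 0]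
    by (auto intro!: eventually_conj eventually_ball_finite)
  then obtain e where e: "\<forall>p\<in>P. T e p $ 1 * T e p $ 2 < 1"
    "\<forall>p\<in>P. \<forall>s\<in>\<Sigma>. \<forall>t\<in>\<Sigma>. s \<noteq> t \<longrightarrow> orient (hyperbola s) (hyperbola t) (T e p) * orient (hyperbola s) (hyperbola t) 0 > 0"
    "\<forall>p\<in>P. \<forall>q\<in>P. \<forall>s\<in>\<Sigma>. p$1 < q$1 \<longrightarrow> orient (T e p) (T e q) (hyperbola s) > 0" "e > 0"
    using eventually_happens'[OF trivial_limit_at_right_real] by blast
  show thesis
  proof (rule that[of "T e ` P"])
    show "horton (T e ` P)" unfolding T_def using P(1) e(4) by (intro horton_shear) auto
    have "inj_on (T e) P"
    proof (rule inj_onI)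
      fix p q assume *: "p \<in> P" "q \<in> P" "T e p = T e q"
      then have "T e p $ 1 = T e q $ 1" by simp
      then have "p$1 = q$1" using e(4) by (simp add: T)
      then show "p = q" using horton_inj[OF P(1)] * by (auto simp: inj_on_def)
    qed
    then show "card (T e ` P) = n" using cardP by (simp add: card_image)
    show "far_below (T e ` P) (hyperbola ` \<Sigma>)" unfolding far_below_def
    proof (intro ballI impI)
      fix a b u assume *: "a \<in> T e ` P" "b \<in> T e ` P" "u \<in> hyperbola ` \<Sigma>" "a$1 < b$1"
      then obtain p q s where pq: "p \<in> P" "q \<in> P" "s \<in> \<Sigma>" "a = T e p" "b = T e q" "u = hyperbola s"
        by blast
      then have "p$1 < q$1" using * e(4) by (simp add: T)
      then show "orient a b u > 0" using e(3) pq by blast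
    qed
  qed (use e in auto)
qed

text \<open>From \<open>(1 + y / 8) ^ 8 \<le> exp y\<close> at \<open>y = m * ln 2\<close>.\<close>
lemma poly_le_exponential:
  obtains K :: real where "K > 0" "\<And>m :: nat. ((real m)\<^sup>2 + 1) ^ 4 \<le> K * 2 ^ m"
proof
  define K where "K = 8 / ln (2 :: real)"
  have ln2: "0 < ln (2 :: real)" "ln (2 :: real) \<le> 8" using ln_le_minus_one[of "2 :: real"] by auto
  then have K: "K \<ge> 1" by (simp add: K_def)
  then show "K ^ 8 > 0" by simp
  show "((real m)\<^sup>2 + 1) ^ 4 \<le> K ^ 8 * 2 ^ m" for m :: nat
  proof -
    define y where "y = real m * ln 2"
    have y: "y \<ge> 0" using ln2 by (simp add: y_def)
    have "real m + 1 \<le> K * (1 + y / 8)"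
      using K ln2 by (simp add: K_def y_def field_simps)
    then have "(real m + 1) ^ 8 \<le> (K * (1 + y / 8)) ^ 8" by (rule power_mono) simp
    also have "\<dots> = K ^ 8 * (1 + y / real 8) ^ 8" by (simp add: power_mult_distrib)
    also have "\<dots> \<le> K ^ 8 * exp y"
      using y K by (intro mult_left_mono exp_ge_one_plus_x_over_n_power_n) auto
    also have "exp y = 2 ^ m" unfolding y_def by (simp add: exp_of_nat_mult)
    finally have "(real m + 1) ^ 8 \<le> K ^ 8 * 2 ^ m" .
    moreover have "((real m)\<^sup>2 + 1) ^ 4 \<le> ((real m + 1)\<^sup>2) ^ 4"
      by (rule power_mono) (auto simp: power2_eq_square algebra_simps)
    moreover have "((real m + 1)\<^sup>2) ^ 4 = (real m + 1) ^ 8" by (simp add: power_mult[symmetric])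
    ultimately show ?thesis by linarith
  qed
qed

text \<open>The parameters exceed \<open>1\<close> on one branch and lie in \<open>(-1, 0)\<close> on the other.  This puts both
  arcs above the line \<open>y = x\<close> and makes the squares of the parameters distinct, as required to place
  the Horton cluster at the origin.\<close>
lemma double_chain_with_horton_cluster:
  fixes m h :: nat
  assumes "m \<ge> 2"
  obtains S where "finite S" "card S = 2 * m + h" "general_position S"
    "card (affine_holes S) \<le> 8 * h\<^sup>2 + 2 * 2 ^ m + (4 * h + 1) * (m\<^sup>2 + 1)\<^sup>2"
    "2 ^ (2 * m - 3) \<le> card (proj_holes (embed_plane ` S))"
proof -
  define I where "I = {2..<m + 2}"
  define \<alpha> where "\<alpha> = real ` I"
  define \<beta> where "\<beta> = (\<lambda>k. 1 / real k) ` I"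
  define \<Sigma> where "\<Sigma> = \<alpha> \<union> uminus ` \<beta>"
  have fin: "finite \<alpha>" "finite \<beta>" "finite \<Sigma>" by (auto simp: \<alpha>_def \<beta>_def \<Sigma>_def I_def)
  have \<alpha>: "s > 1" if "s \<in> \<alpha>" for s using that by (auto simp: \<alpha>_def I_def)
  have \<beta>: "0 < s" "s < 1" if "s \<in> \<beta>" for s using that by (auto simp: \<beta>_def I_def)
  have c\<alpha>: "card \<alpha> = m" unfolding \<alpha>_def by (subst card_image) (auto simp: I_def inj_on_def)
  have c\<beta>: "card \<beta> = m" unfolding \<beta>_def by (subst card_image) (auto simp: I_def inj_on_def)
  have "card (uminus ` \<beta>) = m" using c\<beta> by (subst card_image) auto
  moreover have disj: "\<alpha> \<inter> uminus ` \<beta> = {}" using \<alpha> \<beta> by fastforce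
  ultimately have c\<Sigma>: "card \<Sigma> = 2 * m"
    unfolding \<Sigma>_def using c\<alpha> fin by (subst card_Un_disjoint) auto
  have cases\<Sigma>: "s > 1 \<or> - 1 < s \<and> s < 0" if "s \<in> \<Sigma>" for s
    using that \<alpha> \<beta> by (fastforce simp: \<Sigma>_def)
  have nz: "s \<noteq> 0 \<and> 1 / s < s" if "s \<in> \<Sigma>" for s
    using cases\<Sigma>[OF that]
  proof
    assume "s > 1"
    then have "1 / s < 1" by simp
    then show ?thesis using \<open>s > 1\<close> by linarith
  next
    assume *: "- 1 < s \<and> s < 0"
    have "(- s) * (- s) < 1 * 1" by (rule mult_strict_mono) (use * in auto)
    then have "s * s < 1" by simp
    then show ?thesis using * by (simp add: field_simps)
  qed
  have sq: "s\<^sup>2 \<noteq> t\<^sup>2" if "s \<in> \<Sigma>" "t \<in> \<Sigma>" "s \<noteq> t" for s t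
    using cases\<Sigma>[OF that(1)] cases\<Sigma>[OF that(2)] that(3) by (auto simp: power2_eq_iff)
  obtain H where H: "horton H" "card H = h" "far_below H (hyperbola ` \<Sigma>)"
    "\<And>p. p \<in> H \<Longrightarrow> p$1 * p$2 < 1"
    "\<And>p s t. p \<in> H \<Longrightarrow> s \<in> \<Sigma> \<Longrightarrow> t \<in> \<Sigma> \<Longrightarrow> s \<noteq> t \<Longrightarrow>
       orient (hyperbola s) (hyperbola t) p * orient (hyperbola s) (hyperbola t) 0 > 0"
    by (rule horton_near_origin[OF fin(3), of h])
      (use nz in blast, use sq in blast, rule that, assumption+)
  define A where "A = hyperbola ` \<alpha>"
  \<comment> \<open>With this parametrization by \<open>\<beta>\<close>, the second arc has the same orientation as the first.\<close>
  define f where "f s = - hyperbola s" for s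
  define B where "B = f ` \<beta>"
  define S where "S = H \<union> (A \<union> B)"
  have AB: "A \<union> B = hyperbola ` \<Sigma>"
    by (simp add: A_def B_def f_def \<Sigma>_def image_Un image_image hyperbola_uminus)
  have finH: "finite H" using H(1) horton_finite by blast
  have finS: "finite S" using finH fin by (simp add: S_def AB)
  have on_conic: "p$1 * p$2 = 1" if "p \<in> A \<union> B" for p
    using that nz unfolding AB by auto
  have "card (hyperbola ` \<Sigma>) = 2 * m" using c\<Sigma> by (subst card_image) (auto intro: inj_on_subset[OF inj_hyperbola])
  moreover have "H \<inter> (A \<union> B) = {}" using H(4) on_conic by fastforce
  ultimately have cS: "card S = 2 * m + h"
    unfolding S_def using finH fin H(2) by (subst card_Un_disjoint) (auto simp: AB)
  have gp: "general_position S"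
    unfolding S_def AB
  proof (intro no_three_collinear_imp_general_position no_three_collinear_Un)
    show "no_three_collinear H" by (rule horton_no_three_collinear[OF H(1)])
    show "no_three_collinear (hyperbola ` \<Sigma>)" using nz by (intro no_three_collinear_hyperbola) auto
    show "orient p p' q \<noteq> 0" if "p \<in> H" "p' \<in> H" "q \<in> hyperbola ` \<Sigma>" "p \<noteq> p'" for p p' q
      using far_below_noncollinear[OF H(3) horton_inj[OF H(1)]] that by blast
    show "orient q q' p \<noteq> 0" if q: "q \<in> hyperbola ` \<Sigma>" "q' \<in> hyperbola ` \<Sigma>" "p \<in> H" "q \<noteq> q'" for q q' p
    proof -
      obtain s t where "s \<in> \<Sigma>" "t \<in> \<Sigma>" "q = hyperbola s" "q' = hyperbola t" using q by blast
      then have "s \<in> \<Sigma>" "t \<in> \<Sigma>" "s \<noteq> t" "q = hyperbola s" "q' = hyperbola t" using q(4) by auto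
      then show ?thesis using H(5)[OF q(3), of s t] by auto
    qed
  qed
  have A2: "card (V \<inter> A) \<le> 2"
    if V: "V \<in> hole_sets (H \<union> (A \<union> B))" and p: "p \<in> V" "p \<in> H \<union> B" for V p
    unfolding A_def
  proof (rule arc_vertices_le_2[OF V _ fin(1) p(1)])
    show "orient (hyperbola i) (hyperbola k) (hyperbola j) > 0"
      if "i \<in> \<alpha>" "j \<in> \<alpha>" "k \<in> \<alpha>" "i < j" "j < k" for i j k
    proof -
      have pos: "i > 0" "j > 0" "k > 0" using \<alpha> that by force+
      have "orient (hyperbola i) (hyperbola k) (hyperbola j) = (k - i) * (j - i) * (k - j) / (i * k * j)"
        using pos by (simp add: orient_hyperbola field_simps)
      then show ?thesis using pos that by simp
    qed
    show "orient (hyperbola i) (hyperbola j) p > 0" if ij: "i \<in> \<alpha>" "j \<in> \<alpha>" "i < j" for i j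
    proof -
      have pos: "i > 0" "j > 0" using \<alpha> ij by force+
      then have "i\<^sup>2 < j\<^sup>2" using ij by (simp add: power_strict_mono)
      then have or: "orient (hyperbola i) (hyperbola j) 0 > 0" using pos by (simp add: orient_hyperbola_origin)
      from p(2) show ?thesis
      proof
        assume "p \<in> H"
        then have "orient (hyperbola i) (hyperbola j) p * orient (hyperbola i) (hyperbola j) 0 > 0"
          using ij by (intro H(5)) (auto simp: \<Sigma>_def)
        then show ?thesis using or by (simp add: zero_less_mult_iff)
      next
        assume "p \<in> B"
        then obtain r where r: "r \<in> \<beta>" "p = hyperbola (- r)" by (auto simp: B_def f_def hyperbola_uminus)
        then have "r > 0" using \<beta> by blast
        have "orient (hyperbola i) (hyperbola j) p = (j - i) * (i + r) * (j + r) / (i * j * r)"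
          using pos \<open>r > 0\<close> unfolding r(2) by (simp add: orient_hyperbola field_simps)
        then show ?thesis using pos \<open>r > 0\<close> ij by simp
      qed
    qed
  qed (auto simp: A_def)
  have B2: "card (V \<inter> B) \<le> 2"
    if V: "V \<in> hole_sets (H \<union> (A \<union> B))" and p: "p \<in> V" "p \<in> H \<union> A" for V p
    unfolding B_def
  proof (rule arc_vertices_le_2[OF V _ fin(2) p(1)])
    show "orient (f i) (f k) (f j) > 0"
      if "i \<in> \<beta>" "j \<in> \<beta>" "k \<in> \<beta>" "i < j" "j < k" for i j k
    proof -
      have pos: "i > 0" "j > 0" "k > 0" using \<beta> that by auto
      have "orient (f i) (f k) (f j) = (k - i) * (j - i) * (k - j) / (i * k * j)"
        using pos by (simp add: f_def orient_hyperbola field_simps)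
      then show ?thesis using pos that by simp
    qed
    show "orient (f i) (f j) p > 0" if ij: "i \<in> \<beta>" "j \<in> \<beta>" "i < j" for i j
    proof -
      have pos: "i > 0" "j > 0" using \<beta> ij by auto
      then have "i\<^sup>2 < j\<^sup>2" using ij by (simp add: power_strict_mono)
      then have or: "orient (f i) (f j) 0 > 0"
        using pos by (simp add: f_def orient_hyperbola_origin flip: hyperbola_uminus)
      from p(2) show ?thesis
      proof
        assume "p \<in> H"
        then have "orient (f i) (f j) p * orient (f i) (f j) 0 > 0"
          unfolding f_def hyperbola_uminus[symmetric]
          using ij by (intro H(5)) (auto simp: \<Sigma>_def)
        then show ?thesis using or by (simp add: zero_less_mult_iff)
      next
        assume "p \<in> A"
        then obtain r where r: "r \<in> \<alpha>" "p = hyperbola r" by (auto simp: A_def)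
        then have "r > 0" using \<alpha> by force
        have "orient (f i) (f j) p = (j - i) * (i + r) * (j + r) / (i * j * r)"
          using pos \<open>r > 0\<close> unfolding r(2) f_def hyperbola_uminus[symmetric]
          by (simp add: orient_hyperbola field_simps)
        then show ?thesis using pos \<open>r > 0\<close> ij by simp
      qed
    qed
  qed (auto simp: B_def)
  have finAB: "finite A" "finite B" using fin by (auto simp: A_def B_def)
  have cA: "card A = m"
    unfolding A_def using c\<alpha> by (subst card_image) (auto intro: inj_on_subset[OF inj_hyperbola])
  have cB: "card B = m"
    unfolding B_def using c\<beta> inj_hyperbola by (subst card_image) (auto simp: f_def inj_on_def)
  have "card (affine_holes S) \<le> card (hole_sets S)" by (rule card_affine_holes_le[OF finS])
  also have "\<dots> \<le> 8 * (card H)\<^sup>2 + 2 ^ card A + 2 ^ card B +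
      (4 * card H + 1) * (((card A)\<^sup>2 + 1) * ((card B)\<^sup>2 + 1))"
    unfolding S_def
    by (rule card_hole_sets_horton_arcs[OF H(1) _ finAB A2 B2]) (use H(3) AB in auto)
  also have "\<dots> = 8 * h\<^sup>2 + 2 * 2 ^ m + (4 * h + 1) * (m\<^sup>2 + 1)\<^sup>2"
    by (simp add: cA cB H(2) power2_eq_square)
  finally have aff: "card (affine_holes S) \<le> 8 * h\<^sup>2 + 2 * 2 ^ m + (4 * h + 1) * (m\<^sup>2 + 1)\<^sup>2" .
  have "2 ^ (card \<Sigma> - 3) \<le> card (proj_holes (embed_plane ` S))"
  proof (rule card_proj_holes_ge[OF fin(3)])
    show "card \<Sigma> \<ge> 3" using assms c\<Sigma> by simp
    show "0 \<notin> \<Sigma>" using nz by blast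
    show "hyperbola ` \<Sigma> \<subseteq> S" by (simp add: S_def AB)
    show "p$1 * p$2 \<le> 1" if "p \<in> S" for p
      using that H(4)[of p] on_conic[of p] by (auto simp: S_def)
  qed (rule finS)
  then show thesis using that finS cS gp aff c\<Sigma> by simp
qed

theorem theorem6:
  "\<exists>(C :: real) (c :: real) (N :: nat). C > 0 \<and> c > 0 \<and>
     (\<forall>(n :: nat) (x :: nat). N \<le> n \<and> 0 < n \<and> 0 < x \<and> real x \<le> 2 powr (real n / 2) \<longrightarrow>
        (\<exists>S :: (real^2) set. finite S \<and> card S = n \<and> general_position S \<and>
           real (card (affine_holes S)) \<le> C * (real x + real n ^ 2) \<and>
           real (card (proj_holes (embed_plane ` S))) \<ge> c * real x ^ 2))"
proof -
  obtain K :: real where K: "K > 0" "\<And>m :: nat. ((real m)\<^sup>2 + 1) ^ 4 \<le> K * 2 ^ m"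
    using poly_le_exponential by blast
  define C where "C = 41 + 4 * K"
  have "\<exists>S :: (real^2) set. finite S \<and> card S = n \<and> general_position S \<and>
           real (card (affine_holes S)) \<le> C * (real x + real n ^ 2) \<and>
           real (card (proj_holes (embed_plane ` S))) \<ge> 1 / 32 * real x ^ 2"
    if n: "4 \<le> n" and x: "0 < x" "real x \<le> 2 powr (real n / 2)" for n x :: nat
  proof -
    obtain l where l: "2 ^ l \<le> x" "x < 2 ^ (l + 1)" using ex_power_ivl1[of 2 x] x by auto
    \<comment> \<open>At least three points on the arcs are needed for a projective hole, even if \<open>x = 1\<close>.\<close>
    define m where "m = max 2 l"
    have "2 powr real l = real (2 ^ l)" by (simp add: powr_realpow)
    also have "\<dots> \<le> real x" using l(1) by (rule of_nat_mono)
    also note x(2)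
    finally have "2 powr real l \<le> 2 powr (real n / 2)" .
    then have "2 * l \<le> n" by simp
    then have m: "2 \<le> m" "2 * m \<le> n" using n by (auto simp: m_def)
    have "(2 :: nat) ^ m \<le> 4 * x"
    proof (cases "l \<ge> 2")
      case True
      then show ?thesis using l(1) by (simp add: m_def)
    next
      case False
      then show ?thesis using x(1) by (simp add: m_def)
    qed
    then have "real (2 ^ m) \<le> real (4 * x)" by (rule of_nat_mono)
    then have m4x: "2 ^ m \<le> 4 * real x" by simp
    have "2 ^ (l + 1) \<le> (2 :: nat) ^ (m + 1)" by (rule power_increasing) (auto simp: m_def)
    then have "x \<le> 2 ^ (m + 1)" using l(2) by linarith
    then have "x\<^sup>2 \<le> (2 ^ (m + 1))\<^sup>2" by (rule power_mono) simp
    also have "\<dots> = 2 ^ (2 * m - 3 + 5)"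
      using m by (simp add: power_mult[symmetric] mult.commute)
    also have "\<dots> = 32 * 2 ^ (2 * m - 3)" by (simp only: power_add) simp
    finally have x2: "x\<^sup>2 \<le> 32 * 2 ^ (2 * m - 3)" .
    define h where "h = n - 2 * m"
    have nh: "2 * m + h = n" "h \<le> n" using m by (auto simp: h_def)
    obtain S where S: "finite S" "card S = n" "general_position S"
      "card (affine_holes S) \<le> 8 * h\<^sup>2 + 2 * 2 ^ m + (4 * h + 1) * (m\<^sup>2 + 1)\<^sup>2"
      "2 ^ (2 * m - 3) \<le> card (proj_holes (embed_plane ` S))"
      using double_chain_with_horton_cluster[OF m(1), of h] nh(1) by metis
    have "x\<^sup>2 \<le> 32 * card (proj_holes (embed_plane ` S))" using x2 S(5) by linarith
    then have "real (x\<^sup>2) \<le> real (32 * card (proj_holes (embed_plane ` S)))" by (rule of_nat_mono)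
    then have pr: "1 / 32 * real x ^ 2 \<le> real (card (proj_holes (embed_plane ` S)))" by simp
    define M where "M = ((real m)\<^sup>2 + 1)\<^sup>2"
    define g where "g = 4 * real h + 1"
    have "real (card (affine_holes S)) \<le> real (8 * h\<^sup>2 + 2 * 2 ^ m + (4 * h + 1) * (m\<^sup>2 + 1)\<^sup>2)"
      using S(4) by (rule of_nat_mono)
    also have "\<dots> = 8 * (real h)\<^sup>2 + 2 * 2 ^ m + g * M" by (simp add: M_def g_def algebra_simps)
    finally have a: "real (card (affine_holes S)) \<le> 8 * (real h)\<^sup>2 + 2 * 2 ^ m + g * M" .
    \<comment> \<open>The mixed term is split so that the cluster is charged to \<open>n\<^sup>2\<close> and the arcs to \<open>x\<close>.\<close>
    have "(g - M)\<^sup>2 \<ge> 0" "g\<^sup>2 \<ge> 0" "M\<^sup>2 \<ge> 0" by simp_all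
    then have gM: "g * M \<le> g\<^sup>2 + M\<^sup>2" unfolding power2_diff by linarith
    have "M\<^sup>2 \<le> K * 2 ^ m" using K(2)[of m] by (simp add: M_def power_mult[symmetric])
    also have "\<dots> \<le> K * (4 * real x)" using m4x K(1) by (intro mult_left_mono) auto
    finally have M2: "M\<^sup>2 \<le> 4 * K * real x" by simp
    have "g \<le> 5 * real n" using nh(2) n by (simp add: g_def)
    then have "g\<^sup>2 \<le> (5 * real n)\<^sup>2" by (rule power_mono) (simp add: g_def)
    then have g2: "g\<^sup>2 \<le> 25 * (real n)\<^sup>2" by (simp add: power_mult_distrib)
    have h2: "(real h)\<^sup>2 \<le> (real n)\<^sup>2" using nh(2) by (intro power_mono) auto
    have "real (card (affine_holes S)) \<le> 33 * (real n)\<^sup>2 + 8 * real x + 4 * K * real x"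
      using a gM M2 g2 h2 m4x by linarith
    also have "\<dots> \<le> C * (real x + (real n)\<^sup>2)"
      using K(1) by (simp add: C_def algebra_simps)
    finally show ?thesis using S pr by blast
  qed
  moreover have "C > 0" using K(1) by (simp add: C_def)
  ultimately show ?thesis by (intro exI[of _ C] exI[of _ "1 / 32"] exI[of _ 4]) auto
qed

end
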